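(* There exists a function $\delta:(0,\infty)\times\mathbb{N}\to(0,\infty)$ with $\delta(\epsilon,k)\to 0$ as $\epsilon\to 0$ for every $k\in\mathbb{N}$, such that the following holds for all $k,n\in\mathbb{N}$ (with $k,n\ge1$) and all $\epsilon>0$: if $U_1,\dots,U_k\in\mathbb{C}_{n\times n}$ are unitary matrices with $\|[U_i,U_j]\|_{tr}\le\epsilon$ for all $i,j$, then there exist pairwise commuting unitary matrices $A_1,\dots,A_k\in\mathbb{C}_{n\times n}$ such that $\|U_j-A_j\|_{tr}\le\delta(\epsilon,k)$ for all $j=1,\dots,k$.
   Context: $\mathbb{C}_{n\times n}$ is the set of complex $n\times n$ matrices, $[X,Y]=XY-YX$, and $\|A\|_{tr}=\sqrt{\frac1n\sum_{j,k=1}^n|A_{j,k}|^2}$ is the normalized Hilbert-Schmidt norm on $\mathbb{C}_{n\times n}$. The function $\delta$ does not depend on the dimension $n$. *)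

theory Defs
  imports Complex_Main "Jordan_Normal_Form.Schur_Decomposition"
begin

definition unitary_mat :: "nat \<Rightarrow> complex mat \<Rightarrow> bool" where
  "unitary_mat n U \<longleftrightarrow> U \<in> carrier_mat n n \<and>
     mat_adjoint U * U = 1\<^sub>m n \<and> U * mat_adjoint U = 1\<^sub>m n"

definition commutator_mat :: "complex mat \<Rightarrow> complex mat \<Rightarrow> complex mat" where
  "commutator_mat X Y = X * Y - Y * X"

definition tr_norm :: "complex mat \<Rightarrow> real" where
  "tr_norm A = sqrt (1 / real (dim_row A) *
     (\<Sum>j<dim_row A. \<Sum>k<dim_col A. (cmod (A $$ (j, k)))\<^sup>2))"

end

theory Submission
  imports Defs "HOL-Analysis.L2_Norm"
begin

text \<open>
  Diagonalise one of the unitaries, \<open>U\<^sub>0\<close>, with eigenvalues \<open>\<lambda>\<^sub>a\<close>. In its eigenbasis the squared norm of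
  \<open>[U\<^sub>0, U\<^sub>j]\<close> is the average of \<open>|\<lambda>\<^sub>a - \<lambda>\<^sub>b|\<^sup>2 |(U\<^sub>j)\<^sub>a\<^sub>b|\<^sup>2\<close>, so most of the weight of \<open>U\<^sub>j\<close> sits on pairs of
  close eigenvalues. Cut the plane into a grid of small squares: averaging over shifts of the grid
  gives one for which the squares separate little of this weight. Rounding the eigenvalues of \<open>U\<^sub>0\<close>
  within each square gives a unitary \<open>A\<^sub>0\<close> near \<open>U\<^sub>0\<close>, and deleting the entries of the \<open>U\<^sub>j\<close> between
  different squares gives matrices \<open>B\<^sub>j\<close> near \<open>U\<^sub>j\<close> that commute with \<open>A\<^sub>0\<close>. The unitary polar factor of
  \<open>B\<^sub>j\<close> is the unitary nearest to \<open>B\<^sub>j\<close>, hence also near \<open>U\<^sub>j\<close>, and still commutes with \<open>A\<^sub>0\<close>. The polar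
  factors are again almost commuting, and one continues with these inside the commutant of \<open>A\<^sub>0\<close>.
\<close>

section \<open>Adjoints, unitary matrices and the normalised Hilbert-Schmidt norm\<close>

abbreviation adj :: "complex mat \<Rightarrow> complex mat" where
  "adj \<equiv> mat_adjoint"

lemma adj_carrier [simp]: "A \<in> carrier_mat n m \<Longrightarrow> adj A \<in> carrier_mat m n"
  by (auto simp: mat_adjoint_def)

lemma dim_adj [simp]: "dim_row (adj A) = dim_col A" "dim_col (adj A) = dim_row A"
  by (auto simp: mat_adjoint_def)

lemma index_adj [simp]:
  "i < dim_col A \<Longrightarrow> j < dim_row A \<Longrightarrow> adj A $$ (i, j) = cnj (A $$ (j, i))"
  by (simp add: mat_adjoint_def mat_of_rows_def)

lemma index_mult_carrier:
  assumes "A \<in> carrier_mat n m" "B \<in> carrier_mat m p" "i < n" "j < p"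
  shows "(A * B) $$ (i, j) = (\<Sum>k<m. A $$ (i, k) * B $$ (k, j))"
  using assms by (auto simp: scalar_prod_def atLeast0LessThan intro!: sum.cong)

lemma adj_adj [simp]: "adj (adj A) = A"
  by (rule eq_matI) auto

lemma adj_mult:
  assumes A: "A \<in> carrier_mat n m" and B: "B \<in> carrier_mat m p"
  shows "adj (A * B) = adj B * adj A"
proof (rule eq_matI)
  fix i j assume "i < dim_row (adj B * adj A)" "j < dim_col (adj B * adj A)"
  then have ij: "i < p" "j < n" using A B by auto
  have "adj (A * B) $$ (i, j) = cnj ((A * B) $$ (j, i))" using A B ij by simp
  also have "\<dots> = (\<Sum>k<m. adj B $$ (i, k) * adj A $$ (k, j))"
    using A B ij by (simp add: index_mult_carrier[OF A B] mult.commute del: index_mult_mat)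
  also have "\<dots> = (adj B * adj A) $$ (i, j)"
    using index_mult_carrier[OF adj_carrier[OF B] adj_carrier[OF A] ij] by simp
  finally show "adj (A * B) $$ (i, j) = (adj B * adj A) $$ (i, j)" .
qed (use A B in auto)

lemma adj_one [simp]: "adj (1\<^sub>m n) = 1\<^sub>m n"
  by (rule eq_matI) auto

lemma adj_mat_diag: "adj (mat_diag n f) = mat_diag n (\<lambda>i. cnj (f i))"
  by (rule eq_matI) (auto simp: mat_diag_def)

lemma dim_mat_diag [simp]: "dim_row (mat_diag n f) = n" "dim_col (mat_diag n f) = n"
  by (auto simp: mat_diag_def)

lemma mat_diag_index [simp]: "i < n \<Longrightarrow> j < n \<Longrightarrow> mat_diag n f $$ (i, j) = (if i = j then f i else 0)"
  by (auto simp: mat_diag_def)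

section \<open>Unitary matrices\<close>

lemma unitary_matD:
  assumes "unitary_mat n U"
  shows "U \<in> carrier_mat n n" "adj U * U = 1\<^sub>m n" "U * adj U = 1\<^sub>m n"
  using assms by (auto simp: unitary_mat_def)

lemma unitary_matI:
  assumes "U \<in> carrier_mat n n" "adj U * U = 1\<^sub>m n"
  shows "unitary_mat n U"
  using assms mat_mult_left_right_inverse[OF adj_carrier[OF assms(1)] assms]
  by (simp add: unitary_mat_def)

lemma unitary_adj: "unitary_mat n U \<Longrightarrow> unitary_mat n (adj U)"
  by (auto simp: unitary_mat_def)

lemma unitary_one: "unitary_mat n (1\<^sub>m n)"
  by (simp add: unitary_mat_def)

lemma unitary_cancel:
  assumes "unitary_mat n U" "A \<in> carrier_mat n m"
  shows "adj U * (U * A) = A" "U * (adj U * A) = A"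
proof -
  note U = unitary_matD[OF assms(1)]
  have "adj U * (U * A) = (adj U * U) * A" "U * (adj U * A) = (U * adj U) * A"
    using U(1) assms(2) by (auto simp: assoc_mult_mat[of _ n n _ n _ m])
  then show "adj U * (U * A) = A" "U * (adj U * A) = A"
    using assms(2) by (simp_all add: U)
qed

lemma unitary_mult:
  assumes "unitary_mat n U" "unitary_mat n V"
  shows "unitary_mat n (U * V)"
proof (rule unitary_matI)
  note U = unitary_matD[OF assms(1)] and V = unitary_matD[OF assms(2)]
  show "U * V \<in> carrier_mat n n" using U V by simp
  show "adj (U * V) * (U * V) = 1\<^sub>m n"
    using U(1) V(1) V(2)
    by (simp add: adj_mult[OF U(1) V(1)] assoc_mult_mat[of _ n n _ n _ n] unitary_cancel(1)[OF assms(1), where m=n])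
qed

lemma unitary_mat_diag:
  assumes "\<And>i. i < n \<Longrightarrow> cmod (f i) = 1"
  shows "unitary_mat n (mat_diag n f)"
proof (rule unitary_matI)
  show "adj (mat_diag n f) * mat_diag n f = 1\<^sub>m n"
  proof -
    have "cnj (f i) * f i = 1" if "i < n" for i
      using assms[OF that] by (metis complex_norm_square mult.commute of_real_1 power_one)
    then show ?thesis
      by (auto simp: adj_mat_diag intro!: eq_matI)
  qed
qed simp

text \<open>The square of \<open>tr_norm\<close> without the factor 1/n: a plain sum over the
  entries, for which unitary invariance and entrywise estimates take their simplest form.\<close>

definition hs_sq :: "complex mat \<Rightarrow> real" where
  "hs_sq A = (\<Sum>j<dim_row A. \<Sum>k<dim_col A. (cmod (A $$ (j, k)))\<^sup>2)"

lemma tr_norm_hs_sq: "A \<in> carrier_mat n n \<Longrightarrow> tr_norm A = sqrt (hs_sq A / real n)"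
  by (simp add: tr_norm_def hs_sq_def)

lemma tr_norm_le_iff:
  assumes "A \<in> carrier_mat n n" "n \<ge> 1" "0 \<le> c"
  shows "tr_norm A \<le> c \<longleftrightarrow> hs_sq A \<le> real n * c\<^sup>2"
proof -
  have "tr_norm A \<le> c \<longleftrightarrow> sqrt (hs_sq A / real n) \<le> sqrt (c\<^sup>2)"
    using assms(3) by (simp add: tr_norm_hs_sq[OF assms(1)])
  also have "\<dots> \<longleftrightarrow> hs_sq A / real n \<le> c\<^sup>2"
    by (rule real_sqrt_le_iff)
  finally have "tr_norm A \<le> c \<longleftrightarrow> hs_sq A / real n \<le> c\<^sup>2" .
  then show ?thesis using assms by (simp add: field_simps)
qed

lemma hs_sq_adj: "hs_sq (adj A) = hs_sq A"
  unfolding hs_sq_def by (simp, subst sum.swap, simp)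

text \<open>Each diagonal entry of \<open>adj A * A\<close> is the squared length of a column of
  \<open>A\<close>. A unitary left factor of \<open>A\<close> cancels inside that product, which
  gives unitary invariance.\<close>

lemma hs_sq_gram:
  assumes A: "A \<in> carrier_mat n n"
  shows "hs_sq A = (\<Sum>j<n. Re ((adj A * A) $$ (j, j)))"
proof -
  have "Re ((adj A * A) $$ (j, j)) = (\<Sum>k<n. (cmod (A $$ (k, j)))\<^sup>2)" if "j < n" for j
  proof -
    have "Re (cnj z * z) = (cmod z)\<^sup>2" for z
      unfolding cmod_power2 by (simp add: power2_eq_square)
    then show ?thesis
      using A that by (simp add: index_mult_carrier[OF adj_carrier[OF A] A that that] del: index_mult_mat)
  qed
  moreover have "hs_sq A = (\<Sum>j<n. \<Sum>k<n. (cmod (A $$ (k, j)))\<^sup>2)"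
    unfolding hs_sq_def carrier_matD[OF A] by (rule sum.swap)
  ultimately show ?thesis by (simp del: index_mult_mat)
qed

lemma hs_sq_unitary_left:
  assumes U: "unitary_mat n U" and A: "A \<in> carrier_mat n n"
  shows "hs_sq (U * A) = hs_sq A"
proof -
  have "adj (U * A) * (U * A) = adj A * A"
    using unitary_matD(1)[OF U] A
    by (simp add: adj_mult[of _ n n _ n] assoc_mult_mat[of _ n n _ n _ n] unitary_cancel(1)[OF U A])
  then show ?thesis
    using hs_sq_gram[OF A] hs_sq_gram[OF mult_carrier_mat[OF unitary_matD(1)[OF U] A]] by metis
qed

lemma hs_sq_unitary_right:
  assumes U: "unitary_mat n U" and A: "A \<in> carrier_mat n n"
  shows "hs_sq (A * U) = hs_sq A"
  using hs_sq_unitary_left[OF unitary_adj[OF U] adj_carrier[OF A]]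
  by (metis adj_mult[OF A unitary_matD(1)[OF U]] hs_sq_adj)

lemma hs_sq_unitary_conj:
  assumes U: "unitary_mat n U" and A: "A \<in> carrier_mat n n"
  shows "hs_sq (U * A * adj U) = hs_sq A" "hs_sq (adj U * A * U) = hs_sq A"
proof -
  note c = unitary_matD(1)[OF U]
  show "hs_sq (U * A * adj U) = hs_sq A"
    using hs_sq_unitary_right[OF unitary_adj[OF U] mult_carrier_mat[OF c A]] hs_sq_unitary_left[OF U A]
    by simp
  show "hs_sq (adj U * A * U) = hs_sq A"
    using hs_sq_unitary_right[OF U mult_carrier_mat[OF adj_carrier[OF c] A]]
      hs_sq_unitary_left[OF unitary_adj[OF U] A]
    by simp
qed

lemma hs_sq_unitary: "unitary_mat n U \<Longrightarrow> hs_sq U = real n"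
  by (simp add: hs_sq_gram[OF unitary_matD(1)] unitary_matD del: index_mult_mat)

section \<open>Estimates for the normalised norm\<close>

lemma tr_norm_unitary_left:
  "unitary_mat n U \<Longrightarrow> A \<in> carrier_mat n n \<Longrightarrow> tr_norm (U * A) = tr_norm A"
  using unitary_matD(1)[of n U]
  by (simp add: tr_norm_hs_sq[of _ n] mult_carrier_mat[of _ n n] hs_sq_unitary_left)

lemma tr_norm_unitary_right:
  "unitary_mat n U \<Longrightarrow> A \<in> carrier_mat n n \<Longrightarrow> tr_norm (A * U) = tr_norm A"
  using unitary_matD(1)[of n U]
  by (simp add: tr_norm_hs_sq[of _ n] mult_carrier_mat[of _ n n] hs_sq_unitary_right)

text \<open>Makes the norm a scaled \<open>L2_set\<close> over index pairs, so that its triangle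
  inequality is Minkowski's.\<close>

lemma tr_norm_L2_set:
  assumes "A \<in> carrier_mat n n"
  shows "tr_norm A = sqrt (1 / real n) * L2_set (\<lambda>p. cmod (A $$ p)) ({..<n} \<times> {..<n})"
  using assms
  by (simp add: tr_norm_def L2_set_def real_sqrt_mult real_sqrt_divide sum.cartesian_product)

lemma tr_norm_triangle:
  assumes A: "A \<in> carrier_mat n n" and B: "B \<in> carrier_mat n n"
  shows "tr_norm (A + B) \<le> tr_norm A + tr_norm B"
proof -
  let ?S = "{..<n} \<times> {..<n}"
  have "L2_set (\<lambda>p. cmod ((A + B) $$ p)) ?S \<le> L2_set (\<lambda>p. cmod (A $$ p) + cmod (B $$ p)) ?S"
    using A B by (intro L2_set_mono) (auto intro: norm_triangle_ineq)
  also have "\<dots> \<le> L2_set (\<lambda>p. cmod (A $$ p)) ?S + L2_set (\<lambda>p. cmod (B $$ p)) ?S"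
    by (rule L2_set_triangle_ineq)
  finally show ?thesis
    using mult_left_mono[of _ _ "sqrt (1 / real n)"] A B
    by (simp add: tr_norm_L2_set[of _ n] distrib_left[symmetric])
qed

lemma tr_norm_minus_commute:
  assumes "A \<in> carrier_mat n n" "B \<in> carrier_mat n n"
  shows "tr_norm (A - B) = tr_norm (B - A)"
  using assms by (auto simp: tr_norm_def norm_minus_commute intro!: sum.cong)

lemma tr_norm_triangle_mid:
  assumes "A \<in> carrier_mat n n" "B \<in> carrier_mat n n" "C \<in> carrier_mat n n"
  shows "tr_norm (A - C) \<le> tr_norm (A - B) + tr_norm (B - C)"
proof -
  have "A - C = (A - B) + (B - C)" using assms by (intro eq_matI) auto
  then show ?thesis using tr_norm_triangle[of "A - B" n "B - C"] assms
    by (simp add: minus_carrier_mat)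
qed

lemma tr_norm_unitary: "n \<ge> 1 \<Longrightarrow> unitary_mat n U \<Longrightarrow> tr_norm U = 1"
  using unitary_matD(1)[of n U] by (simp add: tr_norm_hs_sq hs_sq_unitary)

lemma tr_norm_diff_unitary_le:
  assumes "n \<ge> 1" "unitary_mat n U" "unitary_mat n V"
  shows "tr_norm (U - V) \<le> 2"
proof -
  have c: "U \<in> carrier_mat n n" "V \<in> carrier_mat n n" using assms unitary_matD by auto
  have "tr_norm (U - 0\<^sub>m n n) = tr_norm U" "tr_norm (0\<^sub>m n n - V) = tr_norm V"
    using c by (auto simp: tr_norm_def intro!: sum.cong)
  then show ?thesis
    using tr_norm_triangle_mid[OF c(1) zero_carrier_mat c(2)] tr_norm_unitary assms by simp
qed

text \<open>The factors are exchanged one at a time. Each resulting difference carries a unitary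
  factor, which the norm ignores, and each of \<open>U - U'\<close> and \<open>V - V'\<close> arises
  twice up to sign.\<close>

lemma tr_norm_commutator_perturb:
  assumes "unitary_mat n U" "unitary_mat n V" "unitary_mat n U'" "unitary_mat n V'"
  shows "tr_norm (commutator_mat U' V') \<le>
    tr_norm (commutator_mat U V) + 2 * tr_norm (U - U') + 2 * tr_norm (V - V')"
proof -
  have c: "U \<in> carrier_mat n n" "V \<in> carrier_mat n n" "U' \<in> carrier_mat n n" "V' \<in> carrier_mat n n"
    using assms unitary_matD by auto
  have *: "commutator_mat U' V' = commutator_mat U V
    + ((U' - U) * V' + (U * (V' - V) + ((V - V') * U' + V * (U - U'))))"
  proof -
    have "(U' - U) * V' = U' * V' - U * V'" "U * (V' - V) = U * V' - U * V"
      "(V - V') * U' = V * U' - V' * U'" "V * (U - U') = V * U - V * U'"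
      using c by (auto simp: minus_mult_distrib_mat[of _ n n _ _ n] mult_minus_distrib_mat[of _ n n _ n])
    then show ?thesis unfolding commutator_mat_def
      using c by (intro eq_matI) (auto simp del: index_mult_mat(1))
  qed
  have "tr_norm (commutator_mat U' V') \<le> tr_norm (commutator_mat U V)
    + (tr_norm ((U' - U) * V') + (tr_norm (U * (V' - V)) + (tr_norm ((V - V') * U') + tr_norm (V * (U - U')))))"
    unfolding * using c
    by (intro order.trans[OF tr_norm_triangle[of _ n]] add_mono order.refl)
       (auto simp: commutator_mat_def intro!: add_carrier_mat mult_carrier_mat[of _ n n] minus_carrier_mat)
  moreover have "tr_norm ((U' - U) * V') = tr_norm (U - U')" "tr_norm (U * (V' - V)) = tr_norm (V - V')"
    "tr_norm ((V - V') * U') = tr_norm (V - V')" "tr_norm (V * (U - U')) = tr_norm (U - U')"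
    using assms c tr_norm_minus_commute[of U n U'] tr_norm_minus_commute[of V n V']
    by (simp_all add: tr_norm_unitary_left[of n] tr_norm_unitary_right[of n] minus_carrier_mat)
  ultimately show ?thesis by linarith
qed

text \<open>For unitary \<open>W\<close> this is the matrix of \<open>X\<close> in the orthonormal
  basis of the columns of \<open>W\<close>; conjugation with \<open>adj W\<close> goes back.\<close>

definition conj_mat :: "complex mat \<Rightarrow> complex mat \<Rightarrow> complex mat" where
  "conj_mat W X = adj W * X * W"

section \<open>Algebra of a fixed unitary change of basis\<close>

context
  fixes n :: nat and W :: "complex mat"
  assumes W: "unitary_mat n W"
begin

lemma conj_mat_carrier: "X \<in> carrier_mat n n \<Longrightarrow> conj_mat W X \<in> carrier_mat n n"
  unfolding conj_mat_def using unitary_matD(1)[OF W] by (intro mult_carrier_mat[of _ _ n]) auto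

lemma conj_mat_cancel:
  assumes X: "X \<in> carrier_mat n n"
  shows "conj_mat (adj W) (conj_mat W X) = X" "conj_mat W (conj_mat (adj W) X) = X"
  using X unitary_matD[OF W] unitary_cancel[OF W, where m=n]
  by (auto simp: conj_mat_def assoc_mult_mat[of _ n n _ n _ n] mult_carrier_mat[of _ n n])

lemma conj_mat_mult:
  assumes "X \<in> carrier_mat n n" "Y \<in> carrier_mat n n"
  shows "conj_mat W (X * Y) = conj_mat W X * conj_mat W Y"
  using assms unitary_matD[OF W] unitary_cancel[OF W, where m=n]
  by (auto simp: conj_mat_def assoc_mult_mat[of _ n n _ n _ n] mult_carrier_mat[of _ n n])

lemma conj_mat_adj: "X \<in> carrier_mat n n \<Longrightarrow> conj_mat W (adj X) = adj (conj_mat W X)"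
  using unitary_matD(1)[OF W]
  by (auto simp: conj_mat_def adj_mult[of _ n n _ n] assoc_mult_mat[of _ n n _ n _ n] mult_carrier_mat[of _ n n])

lemma conj_mat_one: "conj_mat W (1\<^sub>m n) = 1\<^sub>m n"
  using unitary_matD[OF W] by (simp add: conj_mat_def)

lemma conj_mat_diff:
  assumes "X \<in> carrier_mat n n" "Y \<in> carrier_mat n n"
  shows "conj_mat W (X - Y) = conj_mat W X - conj_mat W Y"
proof -
  have c: "W \<in> carrier_mat n n" "adj W \<in> carrier_mat n n" using unitary_matD(1)[OF W] by auto
  then show ?thesis
    unfolding conj_mat_def mult_minus_distrib_mat[OF c(2) assms]
    using assms by (intro minus_mult_distrib_mat[of _ n n]) auto
qed

lemma conj_mat_unitary: "unitary_mat n X \<Longrightarrow> unitary_mat n (conj_mat W X)"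
  unfolding conj_mat_def by (intro unitary_mult unitary_adj W)

lemma hs_sq_conj_mat: "X \<in> carrier_mat n n \<Longrightarrow> hs_sq (conj_mat W X) = hs_sq X"
  unfolding conj_mat_def by (rule hs_sq_unitary_conj(2)[OF W])

lemma conj_mat_commute_iff:
  assumes "X \<in> carrier_mat n n" "Y \<in> carrier_mat n n"
  shows "conj_mat W X * conj_mat W Y = conj_mat W Y * conj_mat W X \<longleftrightarrow> X * Y = Y * X"
  using assms conj_mat_mult conj_mat_cancel(1) by (metis mult_carrier_mat)

end

section \<open>Diagonalisation of normal matrices\<close>

text \<open>The Gram matrix \<open>adj W * W\<close> is diagonal and carries the positive squared
  column lengths \<open>g i\<close>; dividing column \<open>i\<close> by \<open>sqrt (g i)\<close>
  turns it into the identity.\<close>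

lemma corthogonal_mat_normalize:
  assumes W: "W \<in> carrier_mat n n" and o: "corthogonal_mat W"
  obtains c where "unitary_mat n (W * mat_diag n c)"
proof -
  define g where "g i = (\<Sum>k<n. (cmod (W $$ (k, i)))\<^sup>2)" for i
  have g: "(adj W * W) $$ (i, i) = complex_of_real (g i)" if "i < n" for i
  proof -
    have "(adj W * W) $$ (i, i) = (\<Sum>k<n. cnj (W $$ (k, i)) * W $$ (k, i))"
      using index_mult_carrier[OF adj_carrier[OF W] W that that] W that by simp
    also have "\<dots> = complex_of_real (g i)"
      by (simp only: g_def of_real_sum complex_norm_square mult.commute[of "cnj _"])
    finally show ?thesis .
  qed
  have diag: "adj W * W = mat_diag n (\<lambda>i. complex_of_real (g i))"
  proof (rule eq_matI)
    fix i j
    assume "i < dim_row (mat_diag n (\<lambda>i. complex_of_real (g i)))"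
      "j < dim_col (mat_diag n (\<lambda>i. complex_of_real (g i)))"
    then have ij: "i < n" "j < n" by auto
    have "i \<noteq> j \<Longrightarrow> (adj W * W) $$ (i, j) = 0"
      using o W ij unfolding corthogonal_mat_def diagonal_mat_def Let_def by auto
    then show "(adj W * W) $$ (i, j) = mat_diag n (\<lambda>i. complex_of_real (g i)) $$ (i, j)"
      using g[OF ij(1)] ij by (auto simp del: index_mult_mat)
  qed (use W in auto)
  have pos: "g i > 0" if "i < n" for i
  proof -
    have "(adj W * W) $$ (i, i) \<noteq> 0"
      using o W that unfolding corthogonal_mat_def Let_def by auto
    then have "g i \<noteq> 0" using g[OF that] by simp
    moreover have "g i \<ge> 0" by (simp add: g_def sum_nonneg)
    ultimately show ?thesis by simp
  qed
  define c where "c i = complex_of_real (1 / sqrt (g i))" for i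
  have cc: "c i * (complex_of_real (g i) * c i) = 1" if "i < n" for i
  proof -
    have "1 / sqrt (g i) * (g i * (1 / sqrt (g i))) = 1"
      using pos[OF that] by (simp add: field_simps)
    then show ?thesis unfolding c_def by (metis of_real_1 of_real_mult)
  qed
  have "unitary_mat n (W * mat_diag n c)"
  proof (rule unitary_matI)
    show "W * mat_diag n c \<in> carrier_mat n n" using W by simp
    have ac: "adj (mat_diag n c) = mat_diag n c"
      unfolding adj_mat_diag by (rule eq_matI) (auto simp: c_def)
    have "adj (W * mat_diag n c) * (W * mat_diag n c) = mat_diag n c * ((adj W * W) * mat_diag n c)"
      using W by (simp add: adj_mult[OF W mat_diag_dim] ac assoc_mult_mat[of _ n n _ n _ n])
    also have "\<dots> = mat_diag n (\<lambda>i. c i * (complex_of_real (g i) * c i))"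
      unfolding diag by simp
    also have "\<dots> = 1\<^sub>m n" by (rule eq_matI) (auto simp: cc)
    finally show "adj (W * mat_diag n c) * (W * mat_diag n c) = 1\<^sub>m n" .
  qed
  then show ?thesis by (rule that)
qed

text \<open>An eigenvector exists because the characteristic polynomial splits over the complex
  numbers. It is put first in a basis, and neither Gram-Schmidt nor the normalisation changes the
  line it spans.\<close>

lemma unitary_with_eigencolumn:
  assumes A: "A \<in> carrier_mat (Suc n) (Suc n)"
  obtains W e where "unitary_mat (Suc n) W"
    "\<And>i. i < Suc n \<Longrightarrow> (A * W) $$ (i, 0) = e * W $$ (i, 0)"
proof -
  let ?n = "Suc n"
  obtain as where as: "char_poly A = (\<Prod> a \<leftarrow> as. [:- a, 1:])" "length as = ?n"
    using char_poly_factorized[OF A] by auto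
  then obtain e es where "as = e # es" by (cases as) auto
  then have e: "eigenvalue A e"
    unfolding eigenvalue_root_char_poly[OF A] as(1) by simp
  then obtain v where "eigenvector A v e" by (auto simp: eigenvalue_def)
  then have v: "v \<in> carrier_vec ?n" and v0: "v \<noteq> 0\<^sub>v ?n" and Av: "A *\<^sub>v v = e \<cdot>\<^sub>v v"
    using A unfolding eigenvector_def by auto
  interpret cof_vec_space ?n "TYPE(complex)" .
  define b where "b = basis_completion v"
  from basis_completion[OF v v0, folded b_def]
  have b: "distinct b" "\<not> lin_dep (set b)" "set b \<subseteq> carrier_vec ?n" "hd b = v" "length b = ?n"
    by auto
  then obtain vs where bv: "b = v # vs" by (cases b) auto
  define ws where "ws = gram_schmidt ?n b"
  from gram_schmidt_result[OF b(3,1,2) refl, folded ws_def]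
  have ws: "set ws \<subseteq> carrier_vec ?n" "corthogonal ws" "length ws = ?n"
    by (auto simp: b(5))
  have hd: "hd ws = v" using gram_schmidt_hd[OF v, of vs] unfolding ws_def bv .
  define W where "W = mat_of_cols ?n ws"
  have W: "W \<in> carrier_mat ?n ?n" using ws unfolding W_def by auto
  have "corthogonal_mat W" unfolding W_def by (rule orthogonal_mat_of_cols[OF ws])
  then obtain c where U: "unitary_mat ?n (W * mat_diag ?n c)"
    using corthogonal_mat_normalize[OF W] by blast
  have col: "col W 0 = v"
    using ws hd v unfolding W_def by (cases ws) (auto simp: col_mat_of_cols)
  have eig: "(A * W) $$ (i, 0) = e * W $$ (i, 0)" if "i < ?n" for i
  proof -
    have "(A * W) $$ (i, 0) = (A *\<^sub>v v) $ i" using A W that col by simp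
    also have "\<dots> = e * v $ i" unfolding Av using v that by simp
    also have "v $ i = W $$ (i, 0)" using col W that by (metis carrier_matD index_col zero_less_Suc)
    finally show ?thesis .
  qed
  have "(A * (W * mat_diag ?n c)) $$ (i, 0) = e * (W * mat_diag ?n c) $$ (i, 0)" if i: "i < ?n" for i
  proof -
    have AW: "A * W \<in> carrier_mat ?n ?n" using A W by simp
    have "(A * (W * mat_diag ?n c)) $$ (i, 0) = ((A * W) * mat_diag ?n c) $$ (i, 0)"
      using assoc_mult_mat[OF A W mat_diag_dim] by simp
    also have "\<dots> = (A * W) $$ (i, 0) * c 0"
      using i unfolding mat_diag_mult_right[OF AW] by (simp del: index_mult_mat)
    also have "\<dots> = e * (W * mat_diag ?n c) $$ (i, 0)"
      using i eig[OF i] unfolding mat_diag_mult_right[OF W] by (simp del: index_mult_mat)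
    finally show ?thesis .
  qed
  then show ?thesis using that U by blast
qed

lemma adj_four_block_diag:
  assumes "A \<in> carrier_mat n n" "D \<in> carrier_mat m m"
  shows "adj (four_block_mat A (0\<^sub>m n m) (0\<^sub>m m n) D)
    = four_block_mat (adj A) (0\<^sub>m n m) (0\<^sub>m m n) (adj D)"
  using assms by (intro eq_matI) auto

text \<open>Induction on the dimension: in an orthonormal basis that starts with an eigenvector, the
  first column vanishes below the diagonal, and the induction hypothesis triangularises the
  remaining diagonal block.\<close>

lemma unitary_schur:
  assumes "A \<in> carrier_mat n n"
  shows "\<exists>W T. unitary_mat n W \<and> T \<in> carrier_mat n n \<and> upper_triangular T \<and> A = W * T * adj W"
  using assms
proof (induction n arbitrary: A)
  case 0
  then show ?case
    by (intro exI[of _ "1\<^sub>m 0"] exI[of _ A]) (auto simp: unitary_one intro!: eq_matI)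
next
  case (Suc n)
  note A = Suc.prems
  obtain W e where W: "unitary_mat (Suc n) W"
    and eig: "\<And>i. i < Suc n \<Longrightarrow> (A * W) $$ (i, 0) = e * W $$ (i, 0)"
    using unitary_with_eigencolumn[OF A] by blast
  note Wc = unitary_matD(1)[OF W]
  define B where "B = adj W * (A * W)"
  have B: "B \<in> carrier_mat (Suc n) (Suc n)" 
    unfolding B_def by (intro mult_carrier_mat[of _ _ "Suc n"] adj_carrier A Wc)
  have AWB: "A = W * B * adj W"
  proof -
    have AW: "A * W \<in> carrier_mat (Suc n) (Suc n)" using A Wc by simp
    have "W * B = A * W" unfolding B_def by (rule unitary_cancel(2)[OF W AW])
    then have "W * B * adj W = A * (W * adj W)" using assoc_mult_mat[OF A Wc adj_carrier[OF Wc]] by simp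
    then show ?thesis using A unitary_matD(3)[OF W] by simp
  qed
  \<comment> \<open>Column 0 of \<open>A * W\<close> is \<open>e\<close> times column 0 of
    \<open>W\<close>, and \<open>adj W\<close> maps the latter to the first unit vector.\<close>
  have B0: "B $$ (i, 0) = (if i = 0 then e else 0)" if i: "i < Suc n" for i
  proof -
    have AW: "A * W \<in> carrier_mat (Suc n) (Suc n)" using A Wc by simp
    have "B $$ (i, 0) = (\<Sum>k<Suc n. adj W $$ (i, k) * (A * W) $$ (k, 0))"
      unfolding B_def by (rule index_mult_carrier[OF adj_carrier[OF Wc] AW i]) simp
    also have "\<dots> = e * (\<Sum>k<Suc n. adj W $$ (i, k) * W $$ (k, 0))"
      unfolding sum_distrib_left by (intro sum.cong) (auto simp: eig mult_ac simp del: index_mult_mat)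
    also have "(\<Sum>k<Suc n. adj W $$ (i, k) * W $$ (k, 0)) = (adj W * W) $$ (i, 0)"
      by (rule index_mult_carrier[OF adj_carrier[OF Wc] Wc i, symmetric]) simp
    also have "\<dots> = (if i = 0 then 1 else 0)" using i unitary_matD(2)[OF W] by simp
    finally show ?thesis by auto
  qed
  obtain A1 A2 A0 A3 where split: "split_block B 1 1 = (A1, A2, A0, A3)"
    by (cases "split_block B 1 1") auto
  have dB: "dim_row B = 1 + n" "dim_col B = 1 + n" using B by auto
  note sb = split_block[OF split dB]
  have A0: "A0 = 0\<^sub>m n 1"
    using split B0 B unfolding split_block_def Let_def by (auto intro!: eq_matI)
  obtain W3 T3 where W3: "unitary_mat n W3" and T3: "T3 \<in> carrier_mat n n" "upper_triangular T3"
    and A3: "A3 = W3 * T3 * adj W3"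
    using Suc.IH[OF sb(4)] by blast
  note W3c = unitary_matD(1)[OF W3]
  \<comment> \<open>\<open>P\<close> fixes the first basis vector and triangularises the lower right
    block; \<open>T\<close> is set up to equal \<open>adj P * B * P\<close>.\<close>
  define P where "P = four_block_mat (1\<^sub>m 1) (0\<^sub>m 1 n) (0\<^sub>m n 1) W3"
  define T where "T = four_block_mat A1 (A2 * W3) (0\<^sub>m n 1) T3"
  have adjP: "adj P = four_block_mat (1\<^sub>m 1) (0\<^sub>m 1 n) (0\<^sub>m n 1) (adj W3)"
    unfolding P_def using adj_four_block_diag[OF one_carrier_mat W3c, of 1] by simp
  have P: "unitary_mat (Suc n) P"
  proof (rule unitary_matI)
    show "P \<in> carrier_mat (Suc n) (Suc n)" unfolding P_def using W3c by auto
    have "adj P * P = four_block_mat (1\<^sub>m 1) (0\<^sub>m 1 n) (0\<^sub>m n 1) (1\<^sub>m n)"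
      unfolding adjP unfolding P_def using W3c unitary_matD(2)[OF W3]
      by (subst mult_four_block_mat[of _ 1 1 _ n _ n _ _ 1 _ n]) auto
    also have "\<dots> = 1\<^sub>m (Suc n)" by (rule eq_matI) auto
    finally show "adj P * P = 1\<^sub>m (Suc n)" .
  qed
  note Pc = unitary_matD(1)[OF P]
  have Tc: "T \<in> carrier_mat (Suc n) (Suc n)" unfolding T_def using sb T3 by auto
  have ut: "upper_triangular T" unfolding T_def
    by (intro upper_triangular_four_block[OF sb(1) T3(1) _ T3(2)]) (use sb(1) in auto)
  have PT: "P * T = four_block_mat A1 (A2 * W3) (0\<^sub>m n 1) (W3 * T3)"
    unfolding P_def T_def using W3c sb T3
    by (subst mult_four_block_mat[of _ 1 1 _ n _ n _ _ 1 _ n]) auto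
  have "P * T * adj P = four_block_mat A1 (A2 * W3 * adj W3) (0\<^sub>m n 1) (W3 * T3 * adj W3)"
    unfolding PT adjP using W3c sb T3
    by (subst mult_four_block_mat[of _ 1 1 _ n _ n _ _ 1 _ n]) (auto simp del: assoc_mult_mat)
  also have "A2 * W3 * adj W3 = A2"
    using assoc_mult_mat[OF sb(2) W3c adj_carrier[OF W3c]] unitary_matD(3)[OF W3] sb(2) by simp
  also have "four_block_mat A1 A2 (0\<^sub>m n 1) (W3 * T3 * adj W3) = B"
    using sb(5) A0 A3 by simp
  finally have BP: "B = P * T * adj P" by simp
  have "A = (W * P) * T * adj (W * P)"
    unfolding AWB BP adj_mult[OF Wc Pc] using Wc Pc Tc
    by (simp add: assoc_mult_mat[of _ "Suc n" "Suc n" _ "Suc n" _ "Suc n"]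
        mult_carrier_mat[of _ "Suc n" "Suc n"])
  then show ?case using unitary_mult[OF W P] Tc ut by blast
qed

text \<open>The diagonal entries of \<open>T * adj T\<close> and \<open>adj T * T\<close> are the
  squared lengths of rows and of columns. Once the earlier rows are diagonal, column
  \<open>i\<close> contains only its diagonal entry, and equality of the lengths leaves nothing else
  in row \<open>i\<close>.\<close>

lemma normal_upper_triangular_diagonal:
  assumes T: "T \<in> carrier_mat n n" and ut: "upper_triangular T" and normal: "adj T * T = T * adj T"
    and "i < n" "j < n" "i \<noteq> j"
  shows "T $$ (i, j) = 0"
  using assms(4-6)
proof (induction i arbitrary: j rule: less_induct)
  case (less i)
  have "(\<Sum>k<n. (cmod (T $$ (i, k)))\<^sup>2) = Re ((T * adj T) $$ (i, i))"
    using less.prems T unfolding index_mult_carrier[OF T adj_carrier[OF T] less.prems(1,1)]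
    by (simp add: cmod_power2) (simp add: power2_eq_square)
  also have "\<dots> = Re ((adj T * T) $$ (i, i))" by (simp only: normal)
  also have "\<dots> = (\<Sum>k<n. (cmod (T $$ (k, i)))\<^sup>2)"
    using less.prems T unfolding index_mult_carrier[OF adj_carrier[OF T] T less.prems(1,1)]
    by (simp add: cmod_power2) (simp add: power2_eq_square)
  also have "\<dots> = (\<Sum>k<n. if k = i then (cmod (T $$ (i, i)))\<^sup>2 else 0)"
  proof (rule sum.cong)
    fix k assume "k \<in> {..<n}"
    then show "(cmod (T $$ (k, i)))\<^sup>2 = (if k = i then (cmod (T $$ (i, i)))\<^sup>2 else 0)"
      using less.IH[of k i] less.prems upper_triangularD[OF ut, of i k] T
      by (cases k i rule: linorder_cases) auto
  qed simp
  also have "\<dots> = (cmod (T $$ (i, i)))\<^sup>2" using less.prems by simp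
  finally have "(\<Sum>k\<in>{..<n} - {i}. (cmod (T $$ (i, k)))\<^sup>2) = 0"
    using less.prems by (simp add: sum.remove[of "{..<n}" i])
  then have "\<forall>k\<in>{..<n} - {i}. (cmod (T $$ (i, k)))\<^sup>2 = 0"
    by (subst (asm) sum_nonneg_eq_0_iff) auto
  then show ?case using less.prems by auto
qed

text \<open>Normality survives a unitary change of basis, so the triangular form from
  \<open>unitary_schur\<close> is normal and hence diagonal.\<close>

theorem normal_mat_diagonalizable:
  assumes A: "A \<in> carrier_mat n n" and normal: "adj A * A = A * adj A"
  obtains W d where "unitary_mat n W" "conj_mat W A = mat_diag n d"
proof -
  obtain W T where W: "unitary_mat n W" and T: "T \<in> carrier_mat n n" "upper_triangular T"
    and AW: "A = W * T * adj W"
    using unitary_schur[OF A] by blast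
  have "A = conj_mat (adj W) T" by (simp add: AW conj_mat_def)
  then have TA: "conj_mat W A = T" using conj_mat_cancel(2)[OF W T(1)] by simp
  have "adj T * T = conj_mat W (adj A * A)" "T * adj T = conj_mat W (A * adj A)"
    using conj_mat_mult[OF W adj_carrier[OF A] A] conj_mat_mult[OF W A adj_carrier[OF A]]
      conj_mat_adj[OF W A] TA by simp_all
  then have "adj T * T = T * adj T" using normal by simp
  then have "T = mat_diag n (\<lambda>i. T $$ (i, i))"
    using T normal_upper_triangular_diagonal[OF T] by (intro eq_matI) auto
  then show ?thesis using that W TA by metis
qed

section \<open>The nearest unitary matrix\<close>

lemma commute_mat_diag_imp:
  fixes X :: "complex mat"
  assumes X: "X \<in> carrier_mat n n" and comm: "X * mat_diag n f = mat_diag n f * X"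
    and "i < n" "j < n" "f i \<noteq> f j"
  shows "X $$ (i, j) = 0"
proof -
  have "X $$ (i, j) * f j = f i * X $$ (i, j)"
    using arg_cong[OF comm, of "\<lambda>M. M $$ (i, j)"] assms(3,4)
    unfolding mat_diag_mult_left[OF X] mat_diag_mult_right[OF X] by simp
  then show ?thesis using assms(5) by (metis mult.commute mult_cancel_left)
qed

text \<open>Converse of \<open>commute_mat_diag_imp\<close>. Together they act as a functional
  calculus: whatever commutes with \<open>mat_diag n f\<close> commutes with
  \<open>mat_diag n g\<close> if \<open>f i = f j\<close> always forces
  \<open>g i = g j\<close>.\<close>

lemma commute_mat_diagI:
  fixes X :: "complex mat"
  assumes X: "X \<in> carrier_mat n n" and "\<And>i j. i < n \<Longrightarrow> j < n \<Longrightarrow> g i \<noteq> g j \<Longrightarrow> X $$ (i, j) = 0"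
  shows "X * mat_diag n g = mat_diag n g * X"
proof -
  have "X $$ (i, j) * g j = g i * X $$ (i, j)" if "i < n" "j < n" for i j
    using assms(2)[OF that] by (cases "g i = g j") (auto simp: mult.commute)
  then show ?thesis
    unfolding mat_diag_mult_left[OF X] mat_diag_mult_right[OF X] by (intro eq_matI) auto
qed

text \<open>Taking adjoints shows that \<open>adj X\<close> commutes with \<open>adj B\<close>;
  multiplying by \<open>X\<close> from both sides then cancels \<open>adj X\<close>.\<close>

lemma commute_adj_of_unitary:
  assumes X: "unitary_mat n X" and B: "B \<in> carrier_mat n n" and comm: "X * B = B * X"
  shows "X * adj B = adj B * X"
proof -
  note Xc = unitary_matD(1)[OF X]
  have "adj B * adj X = adj X * adj B" using comm by (metis adj_mult[OF Xc B] adj_mult[OF B Xc])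
  then have "X * (adj B * adj X) * X = X * (adj X * adj B) * X" by simp
  then show ?thesis
    using Xc B unitary_matD[OF X] unitary_cancel[OF X, where m=n]
    by (simp add: assoc_mult_mat[of _ n n _ n _ n] mult_carrier_mat[of _ n n])
qed

lemma unitary_row_norm:
  assumes Q: "unitary_mat n Q" and "i < n"
  shows "(\<Sum>j<n. (cmod (Q $$ (i, j)))\<^sup>2) = 1"
proof -
  note Qc = unitary_matD(1)[OF Q]
  have "1 = Re ((Q * adj Q) $$ (i, i))" using unitary_matD(3)[OF Q] assms(2) by simp
  also have "\<dots> = (\<Sum>j<n. (cmod (Q $$ (i, j)))\<^sup>2)"
    using assms(2) Qc unfolding index_mult_carrier[OF Qc adj_carrier[OF Qc] assms(2,2)]
    by (simp add: cmod_power2) (simp add: power2_eq_square)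
  finally show ?thesis by simp
qed

text \<open>Row \<open>i\<close> of \<open>Q\<close> is a unit vector, so its squared distance from
  row \<open>i\<close> of the diagonal matrix depends only on the real part of the diagonal entry of
  \<open>Q\<close>. As \<open>t i\<close> is nonnegative, the distance decreases in this real part,
  which is at most 1, its value for the identity.\<close>

lemma hs_sq_diag_minus_unitary_ge:
  assumes Q: "unitary_mat n Q" and t: "\<And>i. i < n \<Longrightarrow> 0 \<le> t i"
  shows "hs_sq (mat_diag n (\<lambda>i. complex_of_real (t i)) - 1\<^sub>m n)
    \<le> hs_sq (mat_diag n (\<lambda>i. complex_of_real (t i)) - Q)"
proof -
  let ?D = "mat_diag n (\<lambda>i. complex_of_real (t i))"
  note Qc = unitary_matD(1)[OF Q]
  have row: "(\<Sum>j<n. (cmod ((?D - 1\<^sub>m n) $$ (i, j)))\<^sup>2) \<le> (\<Sum>j<n. (cmod ((?D - Q) $$ (i, j)))\<^sup>2)"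
    if i: "i < n" for i
  proof -
    define z where "z = Q $$ (i, i)"
    have "(\<Sum>j<n. (cmod ((?D - 1\<^sub>m n) $$ (i, j)))\<^sup>2) = (\<Sum>j<n. if j = i then (t i - 1)\<^sup>2 else 0)"
    proof (rule sum.cong)
      fix j assume "j \<in> {..<n}"
      moreover have "(cmod (complex_of_real (t i) - 1))\<^sup>2 = (t i - 1)\<^sup>2"
        by (metis norm_of_real of_real_1 of_real_diff power2_abs)
      ultimately show "(cmod ((?D - 1\<^sub>m n) $$ (i, j)))\<^sup>2 = (if j = i then (t i - 1)\<^sup>2 else 0)"
        using i by auto
    qed simp
    also have "\<dots> = (t i - 1)\<^sup>2" using i by simp
    finally have L: "(\<Sum>j<n. (cmod ((?D - 1\<^sub>m n) $$ (i, j)))\<^sup>2) = (t i - 1)\<^sup>2" .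
    have S: "(cmod z)\<^sup>2 + (\<Sum>j\<in>{..<n} - {i}. (cmod (Q $$ (i, j)))\<^sup>2) = 1"
      using unitary_row_norm[OF Q i] i by (simp add: sum.remove[of "{..<n}" i] z_def)
    have "(\<Sum>j<n. (cmod ((?D - Q) $$ (i, j)))\<^sup>2)
      = (cmod (t i - z))\<^sup>2 + (\<Sum>j\<in>{..<n} - {i}. (cmod (Q $$ (i, j)))\<^sup>2)"
      using i Qc by (auto simp: sum.remove[of "{..<n}" i] z_def intro!: sum.cong)
    also have "\<dots> = (cmod (t i - z))\<^sup>2 + 1 - (cmod z)\<^sup>2" using S by linarith
    also have "\<dots> = (t i)\<^sup>2 - 2 * (t i * Re z) + 1"
      unfolding cmod_power2 by (simp add: power2_eq_square algebra_simps)
    finally have R: "(\<Sum>j<n. (cmod ((?D - Q) $$ (i, j)))\<^sup>2) = (t i)\<^sup>2 - 2 * (t i * Re z) + 1" .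
    have "(cmod z)\<^sup>2 \<le> 1"
      using S sum_nonneg[of "{..<n} - {i}" "\<lambda>j. (cmod (Q $$ (i, j)))\<^sup>2"] by simp
    then have "cmod z \<le> 1" using power2_le_imp_le[of "cmod z" 1] by simp
    then have "Re z \<le> 1" using complex_Re_le_cmod[of z] by linarith
    then have "t i * Re z \<le> t i * 1" using t[OF i] by (intro mult_left_mono)
    then show ?thesis unfolding L R by (simp add: power2_eq_square algebra_simps)
  qed
  have "dim_row (?D - 1\<^sub>m n) = n" "dim_col (?D - 1\<^sub>m n) = n"
    "dim_row (?D - Q) = n" "dim_col (?D - Q) = n"
    using Qc by auto
  then show ?thesis unfolding hs_sq_def by (simp only:) (intro sum_mono row, simp)
qed

text \<open>\<open>V\<close> is the unitary factor of the polar decomposition \<open>B = V H\<close>. It commutes with everything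
  unitary that commutes with \<open>B\<close> because \<open>H\<^sup>-\<^sup>1\<close> is a function of \<open>B\<^sup>* B\<close>.\<close>

lemma nearest_unitary_invertible:
  assumes B: "B \<in> carrier_mat n n" and det: "det B \<noteq> 0"
  obtains V where "unitary_mat n V"
    "\<And>X. unitary_mat n X \<Longrightarrow> X * B = B * X \<Longrightarrow> X * V = V * X"
    "\<And>U. unitary_mat n U \<Longrightarrow> hs_sq (B - V) \<le> hs_sq (B - U)"
proof -
  obtain C where C: "C \<in> carrier_mat n n" "B * C = 1\<^sub>m n" "C * B = 1\<^sub>m n"
    using det_non_zero_imp_unit[OF B det, of "()"] unfolding Units_def ring_mat_def by auto
  define G where "G = adj B * B"
  have G: "G \<in> carrier_mat n n" unfolding G_def by (rule mult_carrier_mat[OF adj_carrier[OF B] B])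
  have aG: "adj G = G" unfolding G_def using B by (simp add: adj_mult[of _ n n _ n])
  obtain W d where W: "unitary_mat n W" and d: "conj_mat W G = mat_diag n d"
    using normal_mat_diagonalizable[OF G] aG by metis
  note Wc = unitary_matD(1)[OF W]
  \<comment> \<open>This exhibits \<open>d i\<close> as the squared length of column
    \<open>i\<close> of \<open>Y\<close>, hence as real and nonnegative.\<close>
  define Y where "Y = B * W"
  have Y: "Y \<in> carrier_mat n n" unfolding Y_def using B Wc by simp
  have YY: "mat_diag n d = adj Y * Y"
    unfolding d[symmetric] Y_def conj_mat_def G_def using B Wc
    by (simp add: adj_mult[of _ n n _ n] assoc_mult_mat[of _ n n _ n _ n] mult_carrier_mat[of _ n n])
  define r where "r i = (\<Sum>k<n. (cmod (Y $$ (k, i)))\<^sup>2)" for i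
  have dr: "d i = complex_of_real (r i)" if "i < n" for i
  proof -
    have "d i = (adj Y * Y) $$ (i, i)" unfolding YY[symmetric] using that by simp
    also have "\<dots> = (\<Sum>k<n. cnj (Y $$ (k, i)) * Y $$ (k, i))"
      using index_mult_carrier[OF adj_carrier[OF Y] Y that that] Y that by simp
    also have "\<dots> = complex_of_real (r i)"
      by (simp only: r_def of_real_sum complex_norm_square mult.commute[of "cnj _"])
    finally show ?thesis .
  qed
  \<comment> \<open>\<open>C * adj C\<close> inverts \<open>G\<close>, so its conjugate inverts
    \<open>mat_diag n d\<close>, and no \<open>d i\<close> can vanish.\<close>
  have r0: "r i > 0" if i: "i < n" for i
  proof -
    let ?Z = "conj_mat W (C * adj C)"
    have CC: "C * adj C \<in> carrier_mat n n" using C by simp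
    have Zc: "?Z \<in> carrier_mat n n" using conj_mat_carrier[OF W CC] .
    have "G * (C * adj C) = adj B * ((B * C) * adj C)"
      unfolding G_def using B C(1)
      by (simp add: assoc_mult_mat[of _ n n _ n _ n] mult_carrier_mat[of _ n n])
    also have "\<dots> = adj (C * B)" unfolding C(2) adj_mult[OF C(1) B] using C(1) by simp
    finally have "G * (C * adj C) = 1\<^sub>m n" using C by simp
    then have "mat_diag n d * ?Z = 1\<^sub>m n"
      using conj_mat_mult[OF W G CC] conj_mat_one[OF W] d by simp
    then have "(mat_diag n d * ?Z) $$ (i, i) = 1" using i by simp
    then have "d i * ?Z $$ (i, i) = 1" using i unfolding mat_diag_mult_left[OF Zc] by simp
    then have "r i \<noteq> 0" using dr[OF i] by auto
    moreover have "r i \<ge> 0" by (simp add: r_def sum_nonneg)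
    ultimately show ?thesis by simp
  qed
  define s where "s i = complex_of_real (sqrt (r i))" for i
  have s0: "s i \<noteq> 0" and ss: "s i * s i = d i" if "i < n" for i
  proof -
    show "s i \<noteq> 0" using r0[OF that] by (simp add: s_def)
    show "s i * s i = d i" using r0[OF that] dr[OF that]
      by (simp add: s_def flip: of_real_mult)
  qed
  \<comment> \<open>\<open>H\<close> is the positive square root of \<open>G\<close> and
    \<open>K\<close> is its inverse; \<open>D'\<close> is \<open>K\<close> in the
    eigenbasis.\<close>
  define D' where "D' = mat_diag n (\<lambda>i. 1 / s i)"
  define K where "K = conj_mat (adj W) D'"
  define H where "H = conj_mat (adj W) (mat_diag n s)"
  have D': "D' \<in> carrier_mat n n" by (simp add: D'_def)
  have aW: "unitary_mat n (adj W)" using unitary_adj[OF W] .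
  have K: "K \<in> carrier_mat n n" and H: "H \<in> carrier_mat n n"
    unfolding K_def H_def by (simp_all add: conj_mat_carrier[OF aW] D')
  have KW: "conj_mat W K = D'" and HW: "conj_mat W H = mat_diag n s"
    unfolding K_def H_def by (simp_all add: conj_mat_cancel[OF W] D')
  have aK: "adj K = K"
  proof -
    have "adj D' = D'" unfolding D'_def adj_mat_diag by (rule eq_matI) (auto simp: s_def)
    then show ?thesis unfolding K_def using conj_mat_adj[OF aW D'] by simp
  qed
  have KH: "K * H = 1\<^sub>m n"
  proof -
    have "D' * mat_diag n s = 1\<^sub>m n" unfolding D'_def
      using s0 by (auto intro!: eq_matI)
    then show ?thesis unfolding K_def H_def
      using conj_mat_mult[OF aW D' mat_diag_dim, of s] conj_mat_one[OF aW] by simp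
  qed
  define V where "V = B * K"
  have Vc: "V \<in> carrier_mat n n" unfolding V_def using B K by simp
  have KGK: "K * (G * K) = 1\<^sub>m n"
  proof -
    have GK: "G * K \<in> carrier_mat n n" using G K by simp
    have "conj_mat W (K * (G * K)) = D' * (mat_diag n d * D')"
      using conj_mat_mult[OF W K GK] conj_mat_mult[OF W G K] KW d by simp
    also have "\<dots> = 1\<^sub>m n" unfolding D'_def
      using s0 by (auto simp: ss[symmetric] intro!: eq_matI)
    finally have "conj_mat (adj W) (conj_mat W (K * (G * K))) = 1\<^sub>m n"
      using conj_mat_one[OF aW] by simp
    then show ?thesis using conj_mat_cancel(1)[OF W mult_carrier_mat[OF K GK]] by simp
  qed
  have V: "unitary_mat n V"
  proof (rule unitary_matI[OF Vc])
    have "adj V * V = K * (G * K)" unfolding V_def adj_mult[OF B K] aK G_def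
      using B K by (simp add: assoc_mult_mat[of _ n n _ n _ n] mult_carrier_mat[of _ n n])
    then show "adj V * V = 1\<^sub>m n" using KGK by simp
  qed
  have VH: "V * H = B" unfolding V_def using KH assoc_mult_mat[OF B K H] B by simp
  show ?thesis
  proof (rule that[OF V])
    fix X assume X: "unitary_mat n X" and XB: "X * B = B * X"
    note Xc = unitary_matD(1)[OF X]
    have "X * G = (X * adj B) * B" unfolding G_def using Xc B by (simp add: assoc_mult_mat[of _ n n _ n _ n])
    also have "\<dots> = adj B * (X * B)"
      unfolding commute_adj_of_unitary[OF X B XB] using Xc B by (simp add: assoc_mult_mat[of _ n n _ n _ n])
    also have "\<dots> = G * X" unfolding XB G_def using Xc B by (simp add: assoc_mult_mat[of _ n n _ n _ n])
    finally have XG: "X * G = G * X" .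
    let ?X = "conj_mat W X"
    have Xc': "?X \<in> carrier_mat n n" using conj_mat_carrier[OF W Xc] .
    have "?X * mat_diag n d = mat_diag n d * ?X"
      using XG conj_mat_commute_iff[OF W Xc G] d by simp
    then have z: "?X $$ (i, j) = 0" if "i < n" "j < n" "d i \<noteq> d j" for i j
      using commute_mat_diag_imp[OF Xc'] that by blast
    \<comment> \<open>\<open>1 / s i\<close> depends only on \<open>d i\<close>, so commuting with
      \<open>G\<close> implies commuting with \<open>K\<close>.\<close>
    have "?X * D' = D' * ?X" unfolding D'_def
      by (rule commute_mat_diagI[OF Xc'], rule z) (auto simp: s_def dr)
    then have XK: "X * K = K * X"
      using conj_mat_commute_iff[OF W Xc K] KW by simp
    have "X * V = (X * B) * K" unfolding V_def using assoc_mult_mat[OF Xc B K] by simp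
    also have "\<dots> = B * (X * K)" unfolding XB using assoc_mult_mat[OF B Xc K] by simp
    also have "\<dots> = V * X" unfolding XK V_def using assoc_mult_mat[OF B K Xc] by simp
    finally show "X * V = V * X" .
  next
    fix U assume U: "unitary_mat n U"
    note Uc = unitary_matD(1)[OF U]
    \<comment> \<open>Cancelling \<open>V\<close> on the left turns \<open>B\<close>,
      \<open>U\<close> and \<open>V\<close> into \<open>H\<close>, \<open>Q\<close> and the
      identity; conjugation with \<open>W\<close> then makes \<open>H\<close> diagonal with
      nonnegative entries.\<close>
    define Q where "Q = adj V * U"
    have Q: "unitary_mat n Q" unfolding Q_def using unitary_mult[OF unitary_adj[OF V] U] .
    have VQ: "V * Q = U" unfolding Q_def by (rule unitary_cancel(2)[OF V Uc])
    note Qc = unitary_matD(1)[OF Q]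
    have "B - V = V * (H - 1\<^sub>m n)" "B - U = V * (H - Q)"
      using mult_minus_distrib_mat[OF Vc H] VH VQ Qc Vc by auto
    then have "hs_sq (B - V) = hs_sq (H - 1\<^sub>m n)" "hs_sq (B - U) = hs_sq (H - Q)"
      using hs_sq_unitary_left[OF V] Qc by (auto simp: minus_carrier_mat)
    moreover have "hs_sq (H - 1\<^sub>m n) = hs_sq (mat_diag n s - 1\<^sub>m n)"
      "hs_sq (H - Q) = hs_sq (mat_diag n s - conj_mat W Q)"
      using hs_sq_conj_mat[OF W minus_carrier_mat[OF one_carrier_mat], of H] 
        hs_sq_conj_mat[OF W minus_carrier_mat[OF Qc], of H]
        conj_mat_diff[OF W H one_carrier_mat] conj_mat_diff[OF W H Qc]
      by (auto simp: HW conj_mat_one[OF W])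
    moreover have "hs_sq (mat_diag n s - 1\<^sub>m n) \<le> hs_sq (mat_diag n s - conj_mat W Q)"
      unfolding s_def using r0
      by (intro hs_sq_diag_minus_unitary_ge conj_mat_unitary[OF W Q]) (auto intro: less_imp_le)
    ultimately show "hs_sq (B - V) \<le> hs_sq (B - U)" by simp
  qed
qed

text \<open>\<open>B\<close> is shifted by a small positive scalar \<open>t\<close> that makes it
  invertible. Adding a scalar matrix preserves commutation, and the shift enters the distance
  estimate twice, whence \<open>t < e/2\<close>.\<close>

lemma nearly_nearest_unitary:
  assumes n: "n \<ge> 1" and B: "B \<in> carrier_mat n n" and e: "e > 0"
  obtains V where "unitary_mat n V"
    "\<And>X. unitary_mat n X \<Longrightarrow> X * B = B * X \<Longrightarrow> X * V = V * X"
    "\<And>U. unitary_mat n U \<Longrightarrow> tr_norm (B - V) \<le> tr_norm (B - U) + e"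
proof -
  \<comment> \<open>The shifted matrix is singular only if \<open>- t\<close> is a root of the
    characteristic polynomial, which excludes finitely many \<open>t\<close>.\<close>
  have "char_poly B \<noteq> 0" using degree_monic_char_poly[OF B] by auto
  then have "finite {x. poly (char_poly B) x = 0}" by (rule poly_roots_finite)
  then have "finite {t::real. poly (char_poly B) (- complex_of_real t) = 0}"
    using finite_vimageI[of "{x. poly (char_poly B) x = 0}" "\<lambda>t. - complex_of_real t"]
    by (auto simp: inj_def vimage_def)
  moreover have "infinite {0<..<e/2}" using e by (intro infinite_Ioo) simp
  ultimately have "\<not> {0<..<e/2} \<subseteq> {t::real. poly (char_poly B) (- complex_of_real t) = 0}"
    using finite_subset by blast
  then obtain t :: real where "t \<in> {0<..<e/2}"
    "t \<notin> {t. poly (char_poly B) (- complex_of_real t) = 0}" by blast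
  then have t: "0 < t" "t < e/2" and root: "poly (char_poly B) (- complex_of_real t) \<noteq> 0"
    by auto
  define B' where "B' = B + complex_of_real t \<cdot>\<^sub>m 1\<^sub>m n"
  have B': "B' \<in> carrier_mat n n" using B by (simp add: B'_def)
  have "B' = char_matrix B (- complex_of_real t)" using B by (simp add: B'_def char_matrix_def)
  then have "det B' \<noteq> 0"
    using root eigenvalue_det[OF B] eigenvalue_root_char_poly[OF B] by simp
  then obtain V where V: "unitary_mat n V"
    "\<And>X. unitary_mat n X \<Longrightarrow> X * B' = B' * X \<Longrightarrow> X * V = V * X"
    "\<And>U. unitary_mat n U \<Longrightarrow> hs_sq (B' - V) \<le> hs_sq (B' - U)"
    using nearest_unitary_invertible[OF B'] by blast
  have "hs_sq (B - B') = hs_sq (mat_diag n (\<lambda>_. complex_of_real t))"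
    unfolding hs_sq_def using B by (auto simp: B'_def intro!: sum.cong)
  also have "\<dots> = (\<Sum>j<n. \<Sum>k<n. if k = j then t\<^sup>2 else 0)"
    unfolding hs_sq_def by (intro sum.cong) auto
  also have "\<dots> = real n * t\<^sup>2" by simp
  finally have BB': "tr_norm (B - B') \<le> t"
    using tr_norm_le_iff[of "B - B'" n t] n t B' by (simp add: minus_carrier_mat)
  show ?thesis
  proof (rule that[OF V(1)])
    fix X assume X: "unitary_mat n X" "X * B = B * X"
    note Xc = unitary_matD(1)[OF X(1)]
    have "X * B' = B' * X" unfolding B'_def
      using Xc B X(2) by (simp add: mult_add_distrib_mat[of _ n n _ n] add_mult_distrib_mat[of _ n n _ _ n]
          mult_smult_distrib[of _ n n _ n] mult_smult_assoc_mat[of _ n n _ n])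
    then show "X * V = V * X" using V(2) X by blast
  next
    fix U assume U: "unitary_mat n U"
    have c: "U \<in> carrier_mat n n" "V \<in> carrier_mat n n" using U V(1) unitary_matD by auto
    have "tr_norm (B' - V) \<le> tr_norm (B' - U)"
      using V(3)[OF U] c n by (auto simp: tr_norm_hs_sq[of _ n] minus_carrier_mat intro!: divide_right_mono)
    moreover have "tr_norm (B - V) \<le> tr_norm (B - B') + tr_norm (B' - V)"
      using tr_norm_triangle_mid[OF B B' c(2)] .
    moreover have "tr_norm (B' - U) \<le> tr_norm (B' - B) + tr_norm (B - U)"
      using tr_norm_triangle_mid[OF B' B c(1)] .
    ultimately show "tr_norm (B - V) \<le> tr_norm (B - U) + e"
      using BB' t tr_norm_minus_commute[OF B B'] by linarith
  qed
qed

section \<open>Pinching along the spectrum of a unitary matrix\<close>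

lemma sum_shifted_div:
  assumes "N > 0"
  shows "(\<Sum>i<N. (m + int i) div int N) = m"
proof -
  \<comment> \<open>The statement is Hermite's identity for floors. Passing from \<open>m\<close> to
    \<open>m + 1\<close> drops the summand \<open>m div int N\<close> and adds
    \<open>(m + int N) div int N\<close>, which is larger by one.\<close>
  have step: "(\<Sum>i<N. (m + 1 + int i) div int N) = (\<Sum>i<N. (m + int i) div int N) + 1" for m
  proof -
    have "(\<Sum>i<N. (m + 1 + int i) div int N) = (\<Sum>i<N. (m + int (Suc i)) div int N)"
      by (simp add: algebra_simps)
    also have "\<dots> = (\<Sum>i<Suc N. (m + int i) div int N) - m div int N"
      by (simp add: sum.lessThan_Suc_shift del: sum.lessThan_Suc)
    also have "\<dots> = (\<Sum>i<N. (m + int i) div int N) + 1" using assms by simp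
    finally show ?thesis .
  qed
  show ?thesis
  proof (induction m rule: int_induct[of _ 0])
    case base
    show ?case by simp
  next
    case (step1 m)
    then show ?case using step[of m] by simp
  next
    case (step2 m)
    then show ?case using step[of "m - 1"] by simp
  qed
qed

text \<open>For \<open>m \<le> m'\<close>, every separating shift adds at least one to the sum of
  the differences of the quotients, and by \<open>sum_shifted_div\<close> this sum is exactly
  \<open>m' - m\<close>.\<close>

lemma card_shifts_separating:
  assumes "N > 0"
  shows "real (card {i\<in>{..<N}. (m + int i) div int N \<noteq> (m' + int i) div int N}) \<le> \<bar>real_of_int m - real_of_int m'\<bar>"
proof -
  have *: "int (card {i\<in>{..<N}. (m + int i) div int N \<noteq> (m' + int i) div int N}) \<le> m' - m"
    if "m \<le> m'" for m m'
  proof -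
    have "int (card {i\<in>{..<N}. (m + int i) div int N \<noteq> (m' + int i) div int N})
      = (\<Sum>i\<in>{i\<in>{..<N}. (m + int i) div int N \<noteq> (m' + int i) div int N}. 1)" by simp
    also have "\<dots> = (\<Sum>i<N. if (m + int i) div int N \<noteq> (m' + int i) div int N then 1 else 0)"
      by (rule sum.inter_filter) simp
    also have "\<dots> \<le> (\<Sum>i<N. (m' + int i) div int N - (m + int i) div int N)"
    proof (rule sum_mono)
      fix i
      have "(m + int i) div int N \<le> (m' + int i) div int N"
        using that assms by (intro zdiv_mono1) auto
      then show "(if (m + int i) div int N \<noteq> (m' + int i) div int N then 1 else 0)
        \<le> (m' + int i) div int N - (m + int i) div int N" by auto
    qed
    also have "\<dots> = m' - m" by (simp add: sum_subtractf sum_shifted_div[OF assms])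
    finally show ?thesis .
  qed
  show ?thesis
  proof (cases "m \<le> m'")
    case True
    then show ?thesis using *[OF True] by linarith
  next
    case False
    then have "int (card {i\<in>{..<N}. (m + int i) div int N \<noteq> (m' + int i) div int N}) \<le> m - m'"
      using *[of m' m] by (metis (mono_tags, lifting) Collect_cong linear)
    then show ?thesis using False by linarith
  qed
qed

lemma abs_floor_diff_le: "\<bar>real_of_int \<lfloor>x\<rfloor> - real_of_int \<lfloor>y\<rfloor>\<bar> \<le> \<bar>x - y\<bar> + (1::real)"
  by linarith

text \<open>Integers in the same block of length \<open>N\<close> differ by at most
  \<open>N - 1\<close>, and the fractional parts contribute less than one more.\<close>

lemma abs_diff_le_of_div_eq:
  assumes "N > 0" "(\<lfloor>x\<rfloor> + int i) div int N = (\<lfloor>y\<rfloor> + int i) div int N"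
  shows "\<bar>x - y\<bar> \<le> real N"
proof -
  have b: "int N * (a div int N) \<le> a" "a < int N * (a div int N) + int N" for a
    using assms(1) mult_div_mod_eq[of "int N" a] pos_mod_bound[of "int N" a] pos_mod_sign[of "int N" a]
    by linarith+
  have "\<lfloor>x\<rfloor> < \<lfloor>y\<rfloor> + int N" "\<lfloor>y\<rfloor> < \<lfloor>x\<rfloor> + int N"
    using b[of "\<lfloor>x\<rfloor> + int i"] b[of "\<lfloor>y\<rfloor> + int i"] unfolding assms(2) by linarith+
  then have "\<lfloor>x\<rfloor> + 1 \<le> \<lfloor>y\<rfloor> + int N" "\<lfloor>y\<rfloor> + 1 \<le> \<lfloor>x\<rfloor> + int N" by linarith+
  then show ?thesis by linarith
qed

text \<open>The cells are squares of side \<open>N \<epsilon>\<close>, shifted diagonally by one of the \<open>N\<close> multiples of \<open>\<epsilon>\<close>.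
  A pair of points is separated by few of the shifts, so some shift separates little of the total weight.\<close>

lemma good_grid:
  fixes d :: "nat \<Rightarrow> complex" and w :: "nat \<Rightarrow> nat \<Rightarrow> real"
  assumes N: "N > 0" and e: "\<epsilon> > 0"
    and w0: "\<And>a b. 0 \<le> w a b"
    and w1: "(\<Sum>a<n. \<Sum>b<n. w a b) \<le> M"
    and w2: "(\<Sum>a<n. \<Sum>b<n. w a b * (cmod (d a - d b))\<^sup>2) \<le> M * \<epsilon>\<^sup>2"
  obtains \<kappa> :: "nat \<Rightarrow> int \<times> int" where
    "\<forall>a b. d a = d b \<longrightarrow> \<kappa> a = \<kappa> b"
    "\<forall>a b. \<kappa> a = \<kappa> b \<longrightarrow> cmod (d a - d b) \<le> 2 * real N * \<epsilon>"
    "(\<Sum>a<n. \<Sum>b<n. if \<kappa> a \<noteq> \<kappa> b then w a b else 0) \<le> 4 * M / real N"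
proof -
  define \<kappa> where "\<kappa> i a =
    ((\<lfloor>Re (d a) / \<epsilon>\<rfloor> + int i) div int N, (\<lfloor>Im (d a) / \<epsilon>\<rfloor> + int i) div int N)" for i a
  have close: "cmod (d a - d b) \<le> 2 * real N * \<epsilon>" if "\<kappa> i a = \<kappa> i b" for i a b
  proof -
    have "\<bar>Re (d a) / \<epsilon> - Re (d b) / \<epsilon>\<bar> \<le> real N" "\<bar>Im (d a) / \<epsilon> - Im (d b) / \<epsilon>\<bar> \<le> real N"
      using that unfolding \<kappa>_def by (auto intro: abs_diff_le_of_div_eq[OF N])
    then have "\<bar>Re (d a - d b)\<bar> \<le> real N * \<epsilon>" "\<bar>Im (d a - d b)\<bar> \<le> real N * \<epsilon>"
      using e by (simp_all add: abs_divide pos_divide_le_eq flip: diff_divide_distrib)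
    then show ?thesis using cmod_le[of "d a - d b"] by linarith
  qed
  have count: "real (card {i\<in>{..<N}. \<kappa> i a \<noteq> \<kappa> i b}) \<le> (cmod (d a - d b))\<^sup>2 / \<epsilon>\<^sup>2 + 3" for a b
  proof -
    let ?R = "{i\<in>{..<N}. (\<lfloor>Re (d a) / \<epsilon>\<rfloor> + int i) div int N \<noteq> (\<lfloor>Re (d b) / \<epsilon>\<rfloor> + int i) div int N}"
    let ?I = "{i\<in>{..<N}. (\<lfloor>Im (d a) / \<epsilon>\<rfloor> + int i) div int N \<noteq> (\<lfloor>Im (d b) / \<epsilon>\<rfloor> + int i) div int N}"
    define x where "x = cmod (d a - d b) / \<epsilon>"
    have "card {i\<in>{..<N}. \<kappa> i a \<noteq> \<kappa> i b} \<le> card (?R \<union> ?I)"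
      unfolding \<kappa>_def by (intro card_mono) auto
    also have "\<dots> \<le> card ?R + card ?I" by (rule card_Un_le)
    finally have "real (card {i\<in>{..<N}. \<kappa> i a \<noteq> \<kappa> i b}) \<le> real (card ?R) + real (card ?I)"
      by linarith
    also have "real (card ?R) \<le> \<bar>Re (d a) / \<epsilon> - Re (d b) / \<epsilon>\<bar> + 1"
      using card_shifts_separating[OF N] abs_floor_diff_le by (rule order.trans)
    also have "\<bar>Re (d a) / \<epsilon> - Re (d b) / \<epsilon>\<bar> \<le> x"
      using abs_Re_le_cmod[of "d a - d b"] e
      by (simp add: x_def abs_divide divide_right_mono flip: diff_divide_distrib)
    also have "real (card ?I) \<le> \<bar>Im (d a) / \<epsilon> - Im (d b) / \<epsilon>\<bar> + 1"
      using card_shifts_separating[OF N] abs_floor_diff_le by (rule order.trans)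
    also have "\<bar>Im (d a) / \<epsilon> - Im (d b) / \<epsilon>\<bar> \<le> x"
      using abs_Im_le_cmod[of "d a - d b"] e
      by (simp add: x_def abs_divide divide_right_mono flip: diff_divide_distrib)
    finally have "real (card {i\<in>{..<N}. \<kappa> i a \<noteq> \<kappa> i b}) \<le> 2 * x + 2" by simp
    \<comment> \<open>The linear bound is traded for a quadratic one, because the total weight and
      the second moment of \<open>w\<close> are the quantities under control.\<close>
    also have "\<dots> \<le> x\<^sup>2 + 3" using zero_le_power2[of "x - 1"] by (simp add: power2_eq_square algebra_simps)
    finally show ?thesis by (simp add: x_def power_divide)
  qed
  define F where "F i = (\<Sum>a<n. \<Sum>b<n. if \<kappa> i a \<noteq> \<kappa> i b then w a b else 0)" for i
  have "(\<Sum>i<N. F i) = (\<Sum>a<n. \<Sum>i<N. \<Sum>b<n. if \<kappa> i a \<noteq> \<kappa> i b then w a b else 0)"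
    unfolding F_def by (rule sum.swap)
  also have "\<dots> = (\<Sum>a<n. \<Sum>b<n. \<Sum>i<N. if \<kappa> i a \<noteq> \<kappa> i b then w a b else 0)"
    by (intro sum.cong refl sum.swap)
  also have "\<dots> = (\<Sum>a<n. \<Sum>b<n. w a b * real (card {i\<in>{..<N}. \<kappa> i a \<noteq> \<kappa> i b}))"
    by (intro sum.cong refl) (simp add: mult.commute flip: sum.inter_filter)
  also have "\<dots> \<le> (\<Sum>a<n. \<Sum>b<n. w a b * ((cmod (d a - d b))\<^sup>2 / \<epsilon>\<^sup>2 + 3))"
    by (intro sum_mono mult_left_mono count w0)
  also have "\<dots> = (\<Sum>a<n. \<Sum>b<n. w a b * (cmod (d a - d b))\<^sup>2) / \<epsilon>\<^sup>2 + 3 * (\<Sum>a<n. \<Sum>b<n. w a b)"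
    by (simp add: sum.distrib distrib_left sum_distrib_left sum_divide_distrib mult.commute)
  \<comment> \<open>The second moment contributes \<open>M\<close> and the constant 3 contributes
    \<open>3 * M\<close>; hence the 4 in the conclusion.\<close>
  also have "\<dots> \<le> M + 3 * M"
    using w1 w2 e by (intro add_mono) (auto simp: pos_divide_le_eq)
  finally have total: "(\<Sum>i<N. F i) \<le> 4 * M" by simp
  \<comment> \<open>Some shift is no worse than the average over all \<open>N\<close> of
    them.\<close>
  have "\<exists>i<N. F i \<le> 4 * M / real N"
  proof (rule ccontr)
    assume "\<not> ?thesis"
    then have "(\<Sum>i<N. 4 * M / real N) < (\<Sum>i<N. F i)"
      using N by (intro sum_strict_mono) (auto simp: not_le)
    then show False using total N by simp
  qed
  then obtain i where i: "F i \<le> 4 * M / real N" by blast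
  show ?thesis
  proof (rule that[of "\<kappa> i"])
    show "\<forall>a b. d a = d b \<longrightarrow> \<kappa> i a = \<kappa> i b" by (simp add: \<kappa>_def)
  qed (use close i in \<open>auto simp: F_def\<close>)
qed

text \<open>In an eigenbasis of \<open>U0\<close>, a good grid on the spectrum sorts the indices
  into cells; \<open>A\<close> is scalar on each cell and each \<open>B j\<close> is block diagonal.
  A matrix commuting with \<open>U0\<close> is block diagonal too, so truncation to the blocks
  preserves commutation with it.\<close>

lemma pinching:
  assumes n: "n \<ge> 1" and e: "\<epsilon> > 0" and N: "N > 0" and J: "finite J"
    and U0: "unitary_mat n U0" and U: "\<And>j. j \<in> J \<Longrightarrow> unitary_mat n (U j)"
    and comm: "\<And>j. j \<in> J \<Longrightarrow> tr_norm (commutator_mat U0 (U j)) \<le> \<epsilon>"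
  obtains A B where "unitary_mat n A" "tr_norm (U0 - A) \<le> 2 * real N * \<epsilon>"
    "\<forall>X\<in>carrier_mat n n. X * U0 = U0 * X \<longrightarrow> X * A = A * X"
    "\<forall>j\<in>J. B j \<in> carrier_mat n n \<and> tr_norm (U j - B j) \<le> sqrt (4 * real (card J) / real N) \<and>
      A * B j = B j * A \<and>
      (\<forall>X\<in>carrier_mat n n. X * U0 = U0 * X \<longrightarrow> X * U j = U j * X \<longrightarrow> X * B j = B j * X)"
proof -
  note U0c = unitary_matD(1)[OF U0]
  obtain W d where W: "unitary_mat n W" and d: "conj_mat W U0 = mat_diag n d"
    using normal_mat_diagonalizable[OF U0c] unitary_matD[OF U0] by metis
  have aW: "unitary_mat n (adj W)" using unitary_adj[OF W] .
  have d1: "cmod (d a) = 1" if a: "a < n" for a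
  proof -
    have "1 = (\<Sum>b<n. (cmod (mat_diag n d $$ (a, b)))\<^sup>2)"
      using unitary_row_norm[OF conj_mat_unitary[OF W U0] a] d by simp
    also have "\<dots> = (\<Sum>b<n. if b = a then (cmod (d a))\<^sup>2 else 0)"
      using a by (intro sum.cong) auto
    also have "\<dots> = (cmod (d a))\<^sup>2" using a by simp
    finally show ?thesis by (metis norm_ge_zero power2_eq_1_iff le_minus_one_simps(3))
  qed
  define T where "T j = conj_mat W (U j)" for j
  have Uc: "U j \<in> carrier_mat n n" if "j \<in> J" for j using unitary_matD(1)[OF U[OF that]] .
  have T: "T j \<in> carrier_mat n n" if "j \<in> J" for j
    unfolding T_def using conj_mat_carrier[OF W Uc[OF that]] .
  \<comment> \<open>The weights of all \<open>U j\<close> are added so that one grid serves every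
    \<open>j\<close>; this is the source of the factor \<open>card J\<close>.\<close>
  define w where "w a b = (\<Sum>j\<in>J. (cmod (T j $$ (a, b)))\<^sup>2)" for a b
  have swapJ: "(\<Sum>a<n. \<Sum>b<n. \<Sum>j\<in>J. f a b j) = (\<Sum>j\<in>J. \<Sum>a<n. \<Sum>b<n. f a b j)"
    for f :: "nat \<Rightarrow> nat \<Rightarrow> _ \<Rightarrow> real"
  proof -
    have "(\<Sum>a<n. \<Sum>b<n. \<Sum>j\<in>J. f a b j) = (\<Sum>a<n. \<Sum>j\<in>J. \<Sum>b<n. f a b j)"
      by (intro sum.cong refl sum.swap)
    also have "\<dots> = (\<Sum>j\<in>J. \<Sum>a<n. \<Sum>b<n. f a b j)" by (rule sum.swap)
    finally show ?thesis .
  qed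
  have "(\<Sum>a<n. \<Sum>b<n. w a b) = (\<Sum>j\<in>J. \<Sum>a<n. \<Sum>b<n. (cmod (T j $$ (a, b)))\<^sup>2)"
    unfolding w_def by (rule swapJ)
  also have "\<dots> = (\<Sum>j\<in>J. hs_sq (T j))"
    by (intro sum.cong refl) (simp add: hs_sq_def carrier_matD[OF T])
  also have "\<dots> = (\<Sum>j\<in>J. real n)"
    unfolding T_def by (intro sum.cong refl hs_sq_unitary conj_mat_unitary[OF W] U)
  finally have w1: "(\<Sum>a<n. \<Sum>b<n. w a b) \<le> real n * real (card J)" by simp
  have "(\<Sum>a<n. \<Sum>b<n. w a b * (cmod (d a - d b))\<^sup>2)
    = (\<Sum>j\<in>J. \<Sum>a<n. \<Sum>b<n. (cmod (T j $$ (a, b)))\<^sup>2 * (cmod (d a - d b))\<^sup>2)"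
    unfolding w_def sum_distrib_right by (rule swapJ)
  also have "\<dots> \<le> (\<Sum>j\<in>J. real n * \<epsilon>\<^sup>2)"
  proof (rule sum_mono)
    fix j assume j: "j \<in> J"
    let ?C = "commutator_mat U0 (U j)"
    have Cc: "?C \<in> carrier_mat n n"
      unfolding commutator_mat_def using U0c Uc[OF j] by (auto intro!: minus_carrier_mat)
    have "conj_mat W ?C = mat_diag n d * T j - T j * mat_diag n d"
      unfolding commutator_mat_def
      using conj_mat_diff[OF W mult_carrier_mat[OF U0c Uc[OF j]] mult_carrier_mat[OF Uc[OF j] U0c]]
        conj_mat_mult[OF W U0c Uc[OF j]] conj_mat_mult[OF W Uc[OF j] U0c] d
      by (simp add: T_def)
    \<comment> \<open>In the eigenbasis each entry of the commutator carries the factor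
      \<open>d a - d b\<close>, so its squared norm is the share of \<open>j\<close> in the second
      moment that \<open>good_grid\<close> needs.\<close>
    also have "\<dots> = mat n n (\<lambda>(a, b). (d a - d b) * T j $$ (a, b))"
      unfolding mat_diag_mult_left[OF T[OF j]] mat_diag_mult_right[OF T[OF j]]
      by (rule eq_matI) (auto simp: algebra_simps)
    finally have "hs_sq ?C = hs_sq (mat n n (\<lambda>(a, b). (d a - d b) * T j $$ (a, b)))"
      using hs_sq_conj_mat[OF W Cc] by simp
    also have "\<dots> = (\<Sum>a<n. \<Sum>b<n. (cmod (T j $$ (a, b)))\<^sup>2 * (cmod (d a - d b))\<^sup>2)"
      by (simp add: hs_sq_def norm_mult power_mult_distrib mult.commute)
    finally show "(\<Sum>a<n. \<Sum>b<n. (cmod (T j $$ (a, b)))\<^sup>2 * (cmod (d a - d b))\<^sup>2) \<le> real n * \<epsilon>\<^sup>2"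
      using comm[OF j] tr_norm_le_iff[OF Cc n] e by simp
  qed
  finally have w2: "(\<Sum>a<n. \<Sum>b<n. w a b * (cmod (d a - d b))\<^sup>2) \<le> real n * real (card J) * \<epsilon>\<^sup>2"
    by (simp add: mult_ac)
  have w0: "0 \<le> w a b" for a b by (simp add: w_def sum_nonneg)
  obtain \<kappa> :: "nat \<Rightarrow> int \<times> int" where k1: "\<forall>a b. d a = d b \<longrightarrow> \<kappa> a = \<kappa> b"
    and k2: "\<forall>a b. \<kappa> a = \<kappa> b \<longrightarrow> cmod (d a - d b) \<le> 2 * real N * \<epsilon>"
    and k3: "(\<Sum>a<n. \<Sum>b<n. if \<kappa> a \<noteq> \<kappa> b then w a b else 0) \<le> 4 * (real n * real (card J)) / real N"
    using good_grid[OF N e w0 w1 w2] .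
  \<comment> \<open>All eigenvalues in a cell are replaced by one of them, so the rounded values
    stay on the unit circle and \<open>A\<close> is unitary.\<close>
  define \<rho> where "\<rho> a = d (SOME b. b < n \<and> \<kappa> b = \<kappa> a)" for a
  have \<rho>: "cmod (\<rho> a) = 1" "cmod (d a - \<rho> a) \<le> 2 * real N * \<epsilon>" if "a < n" for a
  proof -
    have "(SOME b. b < n \<and> \<kappa> b = \<kappa> a) < n \<and> \<kappa> (SOME b. b < n \<and> \<kappa> b = \<kappa> a) = \<kappa> a"
      by (rule someI[of _ a]) (use that in simp)
    then show "cmod (\<rho> a) = 1" "cmod (d a - \<rho> a) \<le> 2 * real N * \<epsilon>"
      unfolding \<rho>_def using d1 k2 by auto
  qed
  have \<rho>\<kappa>: "\<kappa> a = \<kappa> b \<Longrightarrow> \<rho> a = \<rho> b" for a b by (simp add: \<rho>_def)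
  define A where "A = conj_mat (adj W) (mat_diag n \<rho>)"
  have A: "unitary_mat n A"
    unfolding A_def by (intro conj_mat_unitary[OF aW] unitary_mat_diag \<rho>)
  note Ac = unitary_matD(1)[OF A]
  have AW: "conj_mat W A = mat_diag n \<rho>" unfolding A_def by (rule conj_mat_cancel(2)[OF W mat_diag_dim])
  define R where "R j = mat n n (\<lambda>(a, b). if \<kappa> a = \<kappa> b then T j $$ (a, b) else 0)" for j
  have R: "R j \<in> carrier_mat n n" for j by (simp add: R_def)
  have Ri: "R j $$ (a, b) = (if \<kappa> a = \<kappa> b then T j $$ (a, b) else 0)" if "a < n" "b < n" for j a b
    using that by (simp add: R_def)
  define B where "B j = conj_mat (adj W) (R j)" for j
  have Bc: "B j \<in> carrier_mat n n" for j unfolding B_def by (rule conj_mat_carrier[OF aW R])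
  have BW: "conj_mat W (B j) = R j" for j unfolding B_def by (rule conj_mat_cancel(2)[OF W R])
  \<comment> \<open>Equal eigenvalues share a cell, so indices from different cells belong to
    different eigenvalues.\<close>
  have block: "conj_mat W X $$ (a, b) = 0"
    if "X \<in> carrier_mat n n" "X * U0 = U0 * X" "a < n" "b < n" "\<kappa> a \<noteq> \<kappa> b" for X a b
  proof (rule commute_mat_diag_imp[OF conj_mat_carrier[OF W that(1)]])
    show "conj_mat W X * mat_diag n d = mat_diag n d * conj_mat W X"
      using conj_mat_commute_iff[OF W that(1) U0c] that(2) d by simp
    show "d a \<noteq> d b" using k1 that(5) by blast
  qed (use that in auto)
  show ?thesis
  proof (rule that[of A B], goal_cases)
    case 1
    show "unitary_mat n A" by (rule A)
  next
    case 2
    have UA: "U0 - A \<in> carrier_mat n n" using Ac by (rule minus_carrier_mat)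
    have "hs_sq (U0 - A) = hs_sq (mat_diag n d - mat_diag n \<rho>)"
      using hs_sq_conj_mat[OF W UA] conj_mat_diff[OF W U0c Ac] d AW by simp
    also have "\<dots> = (\<Sum>a<n. \<Sum>b<n. if b = a then (cmod (d a - \<rho> a))\<^sup>2 else 0)"
      unfolding hs_sq_def by (intro sum.cong) auto
    also have "\<dots> = (\<Sum>a<n. (cmod (d a - \<rho> a))\<^sup>2)" by simp
    also have "\<dots> \<le> (\<Sum>a<n. (2 * real N * \<epsilon>)\<^sup>2)"
      by (intro sum_mono power_mono \<rho>) auto
    finally show "tr_norm (U0 - A) \<le> 2 * real N * \<epsilon>"
      using tr_norm_le_iff[OF UA n] e by simp
  next
    case 3
    show ?case
    proof (intro ballI impI)
      fix X assume X: "X \<in> carrier_mat n n" "X * U0 = U0 * X"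
      have "conj_mat W X * mat_diag n \<rho> = mat_diag n \<rho> * conj_mat W X"
        by (rule commute_mat_diagI[OF conj_mat_carrier[OF W X(1)]]) (use block[OF X] \<rho>\<kappa> in blast)
      then show "X * A = A * X" using conj_mat_commute_iff[OF W X(1) Ac] AW by simp
    qed
  next
    case 4
    show ?case
    proof (intro ballI conjI impI)
      fix j assume j: "j \<in> J"
      show "B j \<in> carrier_mat n n" by (rule Bc)
      have UB: "U j - B j \<in> carrier_mat n n" using Bc by (rule minus_carrier_mat)
      have "hs_sq (U j - B j) = hs_sq (T j - R j)"
        using hs_sq_conj_mat[OF W UB] conj_mat_diff[OF W Uc[OF j] Bc] BW by (simp add: T_def)
      also have "\<dots> = (\<Sum>a<n. \<Sum>b<n. if \<kappa> a \<noteq> \<kappa> b then (cmod (T j $$ (a, b)))\<^sup>2 else 0)"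
        unfolding hs_sq_def using T[OF j] R[of j] by (intro sum.cong) (auto simp: Ri)
      also have "\<dots> \<le> (\<Sum>a<n. \<Sum>b<n. if \<kappa> a \<noteq> \<kappa> b then w a b else 0)"
        unfolding w_def using j J by (intro sum_mono) (auto intro!: member_le_sum)
      also have "\<dots> \<le> real n * (sqrt (4 * real (card J) / real N))\<^sup>2"
        using k3 N by (simp add: mult_ac)
      finally show "tr_norm (U j - B j) \<le> sqrt (4 * real (card J) / real N)"
        using tr_norm_le_iff[OF UB n] by simp
      have "R j * mat_diag n \<rho> = mat_diag n \<rho> * R j"
        by (rule commute_mat_diagI[OF R]) (metis Ri \<rho>\<kappa>)
      then show "A * B j = B j * A" using conj_mat_commute_iff[OF W Ac Bc, of j] AW BW by simp
      fix X assume X: "X \<in> carrier_mat n n" "X * U0 = U0 * X" "X * U j = U j * X"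
      let ?X = "conj_mat W X"
      have Xc: "?X \<in> carrier_mat n n" by (rule conj_mat_carrier[OF W X(1)])
      have XT: "?X * T j = T j * ?X"
        using conj_mat_commute_iff[OF W X(1) Uc[OF j]] X(3) by (simp add: T_def)
      have "?X * R j = R j * ?X"
      proof (rule eq_matI)
        fix a c assume "a < dim_row (R j * ?X)" "c < dim_col (R j * ?X)"
        then have ac: "a < n" "c < n" using R[of j] Xc by auto
        have "(?X * R j) $$ (a, c) = (\<Sum>b<n. ?X $$ (a, b) * R j $$ (b, c))"
          by (rule index_mult_carrier[OF Xc R ac])
        \<comment> \<open>\<open>?X\<close> vanishes between different cells, so the cutoff
          \<open>\<kappa> b = \<kappa> c\<close> of \<open>R j\<close> may be replaced by
          \<open>\<kappa> a = \<kappa> c\<close>, and the product becomes the truncation of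
          \<open>?X * T j\<close>. The product in the other order is treated symmetrically.\<close>
        also have "\<dots> = (\<Sum>b<n. if \<kappa> a = \<kappa> c then ?X $$ (a, b) * T j $$ (b, c) else 0)"
        proof (intro sum.cong refl)
          fix b assume "b \<in> {..<n}"
          then show "?X $$ (a, b) * R j $$ (b, c) = (if \<kappa> a = \<kappa> c then ?X $$ (a, b) * T j $$ (b, c) else 0)"
            using block[OF X(1,2), of a b] ac by (cases "\<kappa> a = \<kappa> b") (auto simp: Ri)
        qed
        also have "\<dots> = (if \<kappa> a = \<kappa> c then (?X * T j) $$ (a, c) else 0)"
          using index_mult_carrier[OF Xc T[OF j] ac] by simp
        also have "\<dots> = (if \<kappa> a = \<kappa> c then (T j * ?X) $$ (a, c) else 0)" by (simp only: XT)
        also have "\<dots> = (\<Sum>b<n. if \<kappa> a = \<kappa> c then T j $$ (a, b) * ?X $$ (b, c) else 0)"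
          using index_mult_carrier[OF T[OF j] Xc ac] by simp
        also have "\<dots> = (\<Sum>b<n. R j $$ (a, b) * ?X $$ (b, c))"
        proof (intro sum.cong refl)
          fix b assume "b \<in> {..<n}"
          then show "(if \<kappa> a = \<kappa> c then T j $$ (a, b) * ?X $$ (b, c) else 0) = R j $$ (a, b) * ?X $$ (b, c)"
            using block[OF X(1,2), of b c] ac by (cases "\<kappa> b = \<kappa> c") (auto simp: Ri)
        qed
        also have "\<dots> = (R j * ?X) $$ (a, c)"
          by (rule index_mult_carrier[OF R Xc ac, symmetric])
        finally show "(?X * R j) $$ (a, c) = (R j * ?X) $$ (a, c)" .
      qed (use R[of j] Xc in auto)
      then show "X * B j = B j * X"
        using conj_mat_commute_iff[OF W X(1) Bc] BW by simp
    qed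
  qed
qed

section \<open>Almost commuting unitary matrices\<close>

text \<open>The set \<open>S\<close> records the matrices already constructed, so that the induction on \<open>k\<close> does not
  have to pass to the blocks they commute with.\<close>

definition near_commuting :: "nat \<Rightarrow> real \<Rightarrow> real \<Rightarrow> bool" where
  "near_commuting k \<epsilon> \<eta> \<longleftrightarrow> (\<forall>n U S. n \<ge> 1 \<longrightarrow>
     (\<forall>i<k. unitary_mat n (U i)) \<longrightarrow>
     (\<forall>i<k. \<forall>j<k. tr_norm (commutator_mat (U i) (U j)) \<le> \<epsilon>) \<longrightarrow>
     (\<forall>X\<in>S. unitary_mat n X \<and> (\<forall>i<k. X * U i = U i * X)) \<longrightarrow>
     (\<exists>A. (\<forall>i<k. unitary_mat n (A i)) \<and> (\<forall>i<k. \<forall>j<k. A i * A j = A j * A i) \<and>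
          (\<forall>X\<in>S. \<forall>i<k. X * A i = A i * X) \<and> (\<forall>i<k. tr_norm (U i - A i) \<le> \<eta>)))"

lemma near_commutingI:
  assumes "\<And>n U S. n \<ge> 1 \<Longrightarrow> \<forall>i<k. unitary_mat n (U i) \<Longrightarrow>
     \<forall>i<k. \<forall>j<k. tr_norm (commutator_mat (U i) (U j)) \<le> \<epsilon> \<Longrightarrow>
     \<forall>X\<in>S. unitary_mat n X \<and> (\<forall>i<k. X * U i = U i * X) \<Longrightarrow>
     \<exists>A. (\<forall>i<k. unitary_mat n (A i)) \<and> (\<forall>i<k. \<forall>j<k. A i * A j = A j * A i) \<and>
          (\<forall>X\<in>S. \<forall>i<k. X * A i = A i * X) \<and> (\<forall>i<k. tr_norm (U i - A i) \<le> \<eta>)"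
  shows "near_commuting k \<epsilon> \<eta>"
  unfolding near_commuting_def by (intro allI impI) (rule assms)

lemma near_commutingE:
  assumes "near_commuting k \<epsilon> \<eta>" "n \<ge> 1" "\<forall>i<k. unitary_mat n (U i)"
    "\<forall>i<k. \<forall>j<k. tr_norm (commutator_mat (U i) (U j)) \<le> \<epsilon>"
    "\<forall>X\<in>S. unitary_mat n X \<and> (\<forall>i<k. X * U i = U i * X)"
  obtains A where "\<forall>i<k. unitary_mat n (A i)" "\<forall>i<k. \<forall>j<k. A i * A j = A j * A i"
    "\<forall>X\<in>S. \<forall>i<k. X * A i = A i * X" "\<forall>i<k. tr_norm (U i - A i) \<le> \<eta>"
  using assms(1)[unfolded near_commuting_def, THEN spec[of _ n], THEN spec[of _ U], THEN spec[of _ S],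
      THEN mp, OF assms(2), THEN mp, OF assms(3), THEN mp, OF assms(4), THEN mp, OF assms(5)]
  by blast

lemma near_commuting_mono:
  assumes "near_commuting k \<epsilon> \<eta>" "\<epsilon>' \<le> \<epsilon>" "\<eta> \<le> \<eta>'"
  shows "near_commuting k \<epsilon>' \<eta>'"
proof (rule near_commutingI)
  fix n :: nat and U :: "nat \<Rightarrow> complex mat" and S :: "complex mat set"
  assume n: "n \<ge> 1" and U: "\<forall>i<k. unitary_mat n (U i)"
    and C: "\<forall>i<k. \<forall>j<k. tr_norm (commutator_mat (U i) (U j)) \<le> \<epsilon>'"
    and S: "\<forall>X\<in>S. unitary_mat n X \<and> (\<forall>i<k. X * U i = U i * X)"
  have C': "\<forall>i<k. \<forall>j<k. tr_norm (commutator_mat (U i) (U j)) \<le> \<epsilon>"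
    using C order.trans[OF _ assms(2)] by blast
  obtain A where A: "\<forall>i<k. unitary_mat n (A i)" "\<forall>i<k. \<forall>j<k. A i * A j = A j * A i"
    "\<forall>X\<in>S. \<forall>i<k. X * A i = A i * X" "\<forall>i<k. tr_norm (U i - A i) \<le> \<eta>"
    using near_commutingE[OF assms(1) n U C' S] .
  then have "\<forall>i<k. tr_norm (U i - A i) \<le> \<eta>'" using order.trans[OF _ assms(3)] by blast
  with A show "\<exists>A. (\<forall>i<k. unitary_mat n (A i)) \<and> (\<forall>i<k. \<forall>j<k. A i * A j = A j * A i) \<and>
          (\<forall>X\<in>S. \<forall>i<k. X * A i = A i * X) \<and> (\<forall>i<k. tr_norm (U i - A i) \<le> \<eta>')"
    by blast
qed

text \<open>The identity serves as every \<open>A i\<close>, since unitaries are at distance at most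
  2. As this works for every \<open>\<epsilon>\<close>, admissible bounds always exist.\<close>

lemma near_commuting_two: "near_commuting k \<epsilon> 2"
proof (rule near_commutingI)
  fix n :: nat and U :: "nat \<Rightarrow> complex mat" and S :: "complex mat set"
  assume n: "n \<ge> 1" and U: "\<forall>i<k. unitary_mat n (U i)"
    and S: "\<forall>X\<in>S. unitary_mat n X \<and> (\<forall>i<k. X * U i = U i * X)"
  have "X * 1\<^sub>m n = 1\<^sub>m n * X" if "X \<in> S" for X
    using S that unitary_matD(1)[of n X] by simp
  moreover have "tr_norm (U i - 1\<^sub>m n) \<le> 2" if "i < k" for i
    using tr_norm_diff_unitary_le[OF n _ unitary_one] U that by simp
  ultimately show "\<exists>A. (\<forall>i<k. unitary_mat n (A i)) \<and> (\<forall>i<k. \<forall>j<k. A i * A j = A j * A i) \<and>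
          (\<forall>X\<in>S. \<forall>i<k. X * A i = A i * X) \<and> (\<forall>i<k. tr_norm (U i - A i) \<le> 2)"
    by (intro exI[of _ "\<lambda>_. 1\<^sub>m n"]) (auto simp: unitary_one)
qed

text \<open>Induction on \<open>k\<close>: \<open>U k\<close> is rounded to \<open>A0\<close>, the
  other matrices are moved into the commutant of \<open>A0\<close>, where they still almost commute,
  and the induction hypothesis is applied to them with \<open>A0\<close> added to
  \<open>S\<close>.\<close>

theorem almost_commuting_unitaries:
  assumes "\<eta> > 0"
  shows "\<exists>\<epsilon>>0. near_commuting k \<epsilon> \<eta>"
  using assms
proof (induction k arbitrary: \<eta>)
  case 0
  show ?case by (auto simp: near_commuting_def intro: exI[of _ 1])
next
  case (Suc k)
  note \<eta> = Suc.prems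
  then obtain \<epsilon>1 where \<epsilon>1: "\<epsilon>1 > 0" and IH: "near_commuting k \<epsilon>1 (\<eta> / 2)"
    using Suc.IH[of "\<eta> / 2"] by auto
  \<comment> \<open>Each \<open>U j\<close> will move by at most \<open>3 * \<gamma>\<close>, which
    uses up half of \<open>\<eta>\<close>. By \<open>tr_norm_commutator_perturb\<close> the
    commutators then grow by at most \<open>12 * \<gamma>\<close>, half of
    \<open>\<epsilon>1\<close>.\<close>
  define \<gamma> where "\<gamma> = min (\<eta> / 6) (\<epsilon>1 / 24)"
  have \<gamma>: "\<gamma> > 0" "3 * \<gamma> \<le> \<eta> / 2" "12 * \<gamma> \<le> \<epsilon>1 / 2"
    using \<eta> \<epsilon>1 by (auto simp: \<gamma>_def min_def)
  \<comment> \<open>\<open>N\<close> is fixed first, to bound the truncation error by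
    \<open>\<gamma>\<close>; \<open>\<epsilon>\<close> is chosen afterwards, so that the rounding
    error \<open>2 * real N * \<epsilon>\<close> is at most \<open>\<eta>\<close>.\<close>
  obtain N :: nat where N: "4 * real k / \<gamma>\<^sup>2 < real N" using reals_Archimedean2 by blast
  have N0: "N > 0"
  proof -
    have "0 \<le> 4 * real k / \<gamma>\<^sup>2" by simp
    then show ?thesis using N by linarith
  qed
  have "4 * real k / real N \<le> \<gamma>\<^sup>2" using N N0 \<gamma> by (simp add: field_simps)
  then have sq: "sqrt (4 * real k / real N) \<le> \<gamma>" using \<gamma> by (intro real_le_lsqrt) auto
  define \<epsilon> where "\<epsilon> = min (\<epsilon>1 / 2) (\<eta> / (2 * real N))"
  have \<epsilon>: "\<epsilon> > 0" "\<epsilon> \<le> \<epsilon>1 / 2" using \<eta> \<epsilon>1 N0 by (auto simp: \<epsilon>_def)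
  have \<epsilon>N: "2 * real N * \<epsilon> \<le> \<eta>"
  proof -
    have "\<epsilon> \<le> \<eta> / (2 * real N)" by (simp add: \<epsilon>_def)
    then show ?thesis using N0 by (simp add: field_simps)
  qed
  have "near_commuting (Suc k) \<epsilon> \<eta>"
  proof (rule near_commutingI)
    fix n :: nat and U :: "nat \<Rightarrow> complex mat" and S :: "complex mat set"
    assume n: "1 \<le> n" and U: "\<forall>i<Suc k. unitary_mat n (U i)"
      and C: "\<forall>i<Suc k. \<forall>j<Suc k. tr_norm (commutator_mat (U i) (U j)) \<le> \<epsilon>"
      and S: "\<forall>X\<in>S. unitary_mat n X \<and> (\<forall>i<Suc k. X * U i = U i * X)"
    have Uk: "unitary_mat n (U k)" using U by simp
    have Uj: "unitary_mat n (U j)" if "j < k" for j using U that by simp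
    have Uj': "unitary_mat n (U j)" if "j \<in> {..<k}" for j using Uj that by simp
    have Ck: "tr_norm (commutator_mat (U k) (U j)) \<le> \<epsilon>" if "j \<in> {..<k}" for j using C that by simp
    obtain A0 B where A0: "unitary_mat n A0" "tr_norm (U k - A0) \<le> 2 * real N * \<epsilon>"
      and A0X: "\<forall>X\<in>carrier_mat n n. X * U k = U k * X \<longrightarrow> X * A0 = A0 * X"
      and B: "\<forall>j\<in>{..<k}. B j \<in> carrier_mat n n \<and>
        tr_norm (U j - B j) \<le> sqrt (4 * real (card {..<k}) / real N) \<and> A0 * B j = B j * A0 \<and>
        (\<forall>X\<in>carrier_mat n n. X * U k = U k * X \<longrightarrow> X * U j = U j * X \<longrightarrow> X * B j = B j * X)"
      using pinching[OF n \<epsilon>(1) N0 finite_lessThan[of k] Uk Uj' Ck] .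
    have "\<exists>V. unitary_mat n V \<and> (\<forall>X. unitary_mat n X \<longrightarrow> X * B j = B j * X \<longrightarrow> X * V = V * X) \<and>
       tr_norm (U j - V) \<le> 3 * \<gamma>" if j: "j < k" for j
    proof -
      have Bj: "B j \<in> carrier_mat n n" using B j by simp
      obtain V where V: "unitary_mat n V"
        "\<And>X. unitary_mat n X \<Longrightarrow> X * B j = B j * X \<Longrightarrow> X * V = V * X"
        "\<And>U. unitary_mat n U \<Longrightarrow> tr_norm (B j - V) \<le> tr_norm (B j - U) + \<gamma>"
        using nearly_nearest_unitary[OF n Bj \<gamma>(1)] by blast
      have c: "U j \<in> carrier_mat n n" "V \<in> carrier_mat n n"
        using unitary_matD(1) V(1) Uj[OF j] by auto
      have "tr_norm (U j - B j) \<le> sqrt (4 * real (card {..<k}) / real N)" using B j by blast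
      then have "tr_norm (U j - B j) \<le> \<gamma>" using sq by simp
      \<comment> \<open>\<open>U j\<close> is itself a competitor for the unitary nearest to
        \<open>B j\<close>, so \<open>V\<close> is within \<open>2 * \<gamma>\<close> of
        \<open>B j\<close>: the distance to \<open>U j\<close> plus the slack.\<close>
      then have "tr_norm (U j - V) \<le> 3 * \<gamma>"
        using tr_norm_triangle_mid[OF c(1) Bj c(2)] V(3)[OF Uj[OF j]] tr_norm_minus_commute[OF c(1) Bj]
        by linarith
      then show ?thesis using V by blast
    qed
    then obtain V where V: "\<And>j. j < k \<Longrightarrow> unitary_mat n (V j)"
      and VX: "\<And>j X. j < k \<Longrightarrow> unitary_mat n X \<Longrightarrow> X * B j = B j * X \<Longrightarrow> X * V j = V j * X"
      and UV: "\<And>j. j < k \<Longrightarrow> tr_norm (U j - V j) \<le> 3 * \<gamma>"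
      by metis
    have V': "\<forall>j<k. unitary_mat n (V j)" using V by blast
    have CV: "\<forall>i<k. \<forall>j<k. tr_norm (commutator_mat (V i) (V j)) \<le> \<epsilon>1"
    proof (intro allI impI)
      fix i j assume ij: "i < k" "j < k"
      have "tr_norm (commutator_mat (U i) (U j)) \<le> \<epsilon>" using C ij by simp
      then show "tr_norm (commutator_mat (V i) (V j)) \<le> \<epsilon>1"
        using tr_norm_commutator_perturb[OF Uj[OF ij(1)] Uj[OF ij(2)] V[OF ij(1)] V[OF ij(2)]]
          UV[OF ij(1)] UV[OF ij(2)] \<epsilon>(2) \<gamma>(3) by linarith
    qed
    \<comment> \<open>\<open>A0\<close> commutes with \<open>B i\<close> by construction, and
      members of \<open>S\<close> do because they commute with \<open>U k\<close> and
      \<open>U i\<close>; the choice of \<open>V i\<close> carries both over.\<close>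
    have SV: "\<forall>X\<in>insert A0 S. unitary_mat n X \<and> (\<forall>i<k. X * V i = V i * X)"
    proof (intro ballI conjI allI impI)
      fix X assume X: "X \<in> insert A0 S"
      then show "unitary_mat n X" using A0 S by auto
      then have Xc: "X \<in> carrier_mat n n" by (rule unitary_matD)
      fix i assume i: "i < k"
      have "X * B i = B i * X"
      proof (cases "X = A0")
        case True
        then show ?thesis using B i by blast
      next
        case False
        then have "X * U k = U k * X" "X * U i = U i * X" using X S i by auto
        then show ?thesis using B i Xc by blast
      qed
      then show "X * V i = V i * X" using VX[OF i \<open>unitary_mat n X\<close>] by blast
    qed
    obtain A where A: "\<forall>i<k. unitary_mat n (A i)" "\<forall>i<k. \<forall>j<k. A i * A j = A j * A i"
      "\<forall>X\<in>insert A0 S. \<forall>i<k. X * A i = A i * X" "\<forall>i<k. tr_norm (V i - A i) \<le> \<eta> / 2"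
      using near_commutingE[OF IH n V' CV SV] .
    have UA: "tr_norm (U i - A i) \<le> \<eta>" if "i < k" for i
    proof -
      have "unitary_mat n (A i)" "tr_norm (V i - A i) \<le> \<eta> / 2" using A that by blast+
      then show ?thesis
        using tr_norm_triangle_mid[OF unitary_matD(1)[OF Uj[OF that]] unitary_matD(1)[OF V[OF that]]
            unitary_matD(1)] UV[OF that] \<gamma>(2) by fastforce
    qed
    have A0S: "X * A0 = A0 * X" if "X \<in> S" for X
      using A0X S that unitary_matD(1) by blast
    show "\<exists>A. (\<forall>i<Suc k. unitary_mat n (A i)) \<and> (\<forall>i<Suc k. \<forall>j<Suc k. A i * A j = A j * A i) \<and>
        (\<forall>X\<in>S. \<forall>i<Suc k. X * A i = A i * X) \<and> (\<forall>i<Suc k. tr_norm (U i - A i) \<le> \<eta>)"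
    proof (intro exI[of _ "A(k := A0)"] conjI allI impI ballI)
      fix i assume "i < Suc k"
      then show "unitary_mat n ((A(k := A0)) i)" using A(1) A0 by (auto simp: less_Suc_eq)
    next
      fix i j assume "i < Suc k" "j < Suc k"
      \<comment> \<open>When one index is \<open>k\<close>, the claim holds because
        \<open>A0\<close> belongs to the set handed to the induction hypothesis.\<close>
      then show "(A(k := A0)) i * (A(k := A0)) j = (A(k := A0)) j * (A(k := A0)) i"
        using A(2,3) by (cases "i = k"; cases "j = k") (simp_all add: less_Suc_eq)
    next
      fix X i assume "X \<in> S" "i < Suc k"
      then show "X * (A(k := A0)) i = (A(k := A0)) i * X"
        using A(3) A0S by (cases "i = k") (simp_all add: less_Suc_eq)
    next
      fix i assume "i < Suc k"
      then show "tr_norm (U i - (A(k := A0)) i) \<le> \<eta>"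
        using UA A0(2) \<epsilon>N by (auto simp: less_Suc_eq)
    qed
  qed
  then show ?case using \<epsilon>(1) by blast
qed

section \<open>The function \<open>\<delta>\<close>\<close>

theorem theorem2:
  shows "\<exists>\<delta> :: real \<Rightarrow> nat \<Rightarrow> real.
  (\<forall>\<epsilon>>0. \<forall>k. \<delta> \<epsilon> k > 0) \<and>
  (\<forall>k. ((\<lambda>\<epsilon>. \<delta> \<epsilon> k) \<longlongrightarrow> 0) (at_right 0)) \<and>
  (\<forall>k\<ge>1. \<forall>n\<ge>1. \<forall>\<epsilon>>0. \<forall>U :: nat \<Rightarrow> complex mat.
     (\<forall>i\<in>{1..k}. unitary_mat n (U i)) \<longrightarrow>
     (\<forall>i\<in>{1..k}. \<forall>j\<in>{1..k}. tr_norm (commutator_mat (U i) (U j)) \<le> \<epsilon>) \<longrightarrow>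
     (\<exists>A :: nat \<Rightarrow> complex mat.
        (\<forall>i\<in>{1..k}. unitary_mat n (A i)) \<and>
        (\<forall>i\<in>{1..k}. \<forall>j\<in>{1..k}. A i * A j = A j * A i) \<and>
        (\<forall>j\<in>{1..k}. tr_norm (U j - A j) \<le> \<delta> \<epsilon> k)))"
proof -
  \<comment> \<open>\<open>near_commuting\<close> quantifies over all dimensions, so
    \<open>\<delta>\<close> does not depend on \<open>n\<close>. For positive
    \<open>\<epsilon>\<close> the summand \<open>\<epsilon>\<close> makes \<open>\<delta>\<close>
    positive and pushes it strictly above the infimum, hence above some admissible bound.\<close>
  define E where "E \<epsilon> k = {\<eta>. 0 \<le> \<eta> \<and> near_commuting k \<epsilon> \<eta>}" for \<epsilon> k
  define \<delta> where "\<delta> \<epsilon> k = Inf (E \<epsilon> k) + \<epsilon>" for \<epsilon> k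
  have ne: "E \<epsilon> k \<noteq> {}" for \<epsilon> k
    unfolding E_def using near_commuting_two by (auto intro!: exI[of _ 2])
  have bdd: "bdd_below (E \<epsilon> k)" for \<epsilon> k unfolding E_def by (intro bdd_belowI[of _ 0]) auto
  have nonneg: "0 \<le> Inf (E \<epsilon> k)" for \<epsilon> k
    by (rule cInf_greatest[OF ne]) (auto simp: E_def)
  show ?thesis
  proof (intro exI[of _ \<delta>] conjI allI impI)
    show "\<delta> \<epsilon> k > 0" if "\<epsilon> > 0" for \<epsilon> k using nonneg[of \<epsilon> k] that by (simp add: \<delta>_def)
  next
    fix k
    show "((\<lambda>\<epsilon>. \<delta> \<epsilon> k) \<longlongrightarrow> 0) (at_right 0)"
    proof (rule tendstoI)
      fix e :: real assume e: "e > 0"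
      then obtain \<epsilon>0 where \<epsilon>0: "\<epsilon>0 > 0" "near_commuting k \<epsilon>0 (e / 2)"
        using almost_commuting_unitaries[of "e / 2" k] by auto
      \<comment> \<open>The infimum contributes at most \<open>e / 2\<close> by monotonicity in
        \<open>\<epsilon>\<close>, and the summand \<open>\<epsilon>\<close> less than
        \<open>e / 2\<close>.\<close>
      have "dist (\<delta> \<epsilon> k) 0 < e" if "0 < \<epsilon>" "\<epsilon> < min \<epsilon>0 (e / 2)" for \<epsilon>
      proof -
        have "e / 2 \<in> E \<epsilon> k" using near_commuting_mono[OF \<epsilon>0(2), of \<epsilon> "e / 2"] that e by (simp add: E_def)
        then have "Inf (E \<epsilon> k) \<le> e / 2" by (rule cInf_lower[OF _ bdd])
        then show ?thesis using nonneg[of \<epsilon> k] that by (simp add: \<delta>_def dist_real_def)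
      qed
      then show "\<forall>\<^sub>F \<epsilon> in at_right 0. dist (\<delta> \<epsilon> k) 0 < e"
        unfolding eventually_at_right_field using e \<epsilon>0
        by (intro exI[of _ "min \<epsilon>0 (e / 2)"]) auto
    qed
  next
    fix k n :: nat and \<epsilon> :: real and U :: "nat \<Rightarrow> complex mat"
    assume n: "1 \<le> n" and \<epsilon>: "0 < \<epsilon>" and U: "\<forall>i\<in>{1..k}. unitary_mat n (U i)"
      and C: "\<forall>i\<in>{1..k}. \<forall>j\<in>{1..k}. tr_norm (commutator_mat (U i) (U j)) \<le> \<epsilon>"
    obtain \<eta> where "\<eta> \<in> E \<epsilon> k" "\<eta> < \<delta> \<epsilon> k"
      using cInf_lessD[OF ne, of \<epsilon> k "\<delta> \<epsilon> k"] \<epsilon> by (auto simp: \<delta>_def)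
    then have nc: "near_commuting k \<epsilon> (\<delta> \<epsilon> k)"
      using near_commuting_mono[of k \<epsilon> \<eta> \<epsilon> "\<delta> \<epsilon> k"] by (simp add: E_def)
    \<comment> \<open>The matrices are numbered from 1 here and from 0 in
      \<open>near_commuting\<close>, so the indices are shifted by one; \<open>S\<close> starts out
      empty.\<close>
    have U': "\<forall>i<k. unitary_mat n (U (Suc i))" using U by simp
    have C': "\<forall>i<k. \<forall>j<k. tr_norm (commutator_mat (U (Suc i)) (U (Suc j))) \<le> \<epsilon>" using C by simp
    have S': "\<forall>X\<in>{}. unitary_mat n X \<and> (\<forall>i<k. X * U (Suc i) = U (Suc i) * X)" by simp
    obtain A where A: "\<forall>i<k. unitary_mat n (A i)" "\<forall>i<k. \<forall>j<k. A i * A j = A j * A i"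
      "\<forall>X\<in>{}. \<forall>i<k. X * A i = A i * X" "\<forall>i<k. tr_norm (U (Suc i) - A i) \<le> \<delta> \<epsilon> k"
      using near_commutingE[OF nc n U' C' S'] .
    have i: "i - 1 < k" "Suc (i - 1) = i" if "i \<in> {1..k}" for i using that by auto
    show "\<exists>A. (\<forall>i\<in>{1..k}. unitary_mat n (A i)) \<and> (\<forall>i\<in>{1..k}. \<forall>j\<in>{1..k}. A i * A j = A j * A i) \<and>
        (\<forall>j\<in>{1..k}. tr_norm (U j - A j) \<le> \<delta> \<epsilon> k)"
    proof (intro exI[of _ "\<lambda>i. A (i - 1)"] conjI ballI)
      fix j assume "j \<in> {1..k}"
      then show "tr_norm (U j - A (j - 1)) \<le> \<delta> \<epsilon> k" using A(4) i by metis
    next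
      fix j assume "j \<in> {1..k}"
      then show "unitary_mat n (A (j - 1))" using A(1) i by blast
    next
      fix j l assume "j \<in> {1..k}" "l \<in> {1..k}"
      then show "A (j - 1) * A (l - 1) = A (l - 1) * A (j - 1)" using A(2) i by blast
    qed
  qed
qed

end
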